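(* If $\alpha=1$ or if there are no intermediate layers ($\lambda=0$), then FLaMECaST (computing a valid layout of minimum cost, or deciding that none exists) is solvable in $O((c_0\cdot|T|)^3)$ time, where $|T|$ is the number of sinks and $c_0$ is the sink capacity.
   Context: FLaMECaST: an instance $I=(S,T,C,\alpha)$ consists of a finite set $S$ of sources and a finite set $T$ of sinks, each with a fixed position in $\mathbb{R}^2$ (several sources may share a position), capacities $C=(c_0,\dots,c_{\lambda+1})$ with integers $c_0\ge c_1\ge\dots\ge c_{\lambda+1}\ge 1$ ($\lambda\ge 0$ is the number of intermediate layers), and a parameter $\alpha\in[0,1]$. A topology is a rooted forest (edges directed from child to parent) of height at most $\lambda+1$ whose leaves are exactly $S$ and whose roots form a subset of $T$; its other vertices are Steiner vertices. The layer of a vertex is the number of edges on its path to its root. The load $\ell(v)$ of a vertex is the number of sources in its subtree; the load of an edge $uv$ ($u$ child of $v$) is $\ell(u)$. A topology is valid if $\ell(v)\le c_i$ for every vertex $v$ in layer $i$. An embedding maps each vertex to a point of $\mathbb{R}^2$, sources and sinks to their given positions and Steiner vertices arbitrarily; a topology with an embedding is a layout (valid if its topology is valid). The cost of an edge $uv$ is $\|\mathrm{pos}(u)-\mathrm{pos}(v)\|\cdot\ell(uv)^\alpha$ and the cost of a layout is the sum of its edge costs. The goal is a valid layout of minimum cost. *)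

theory Defs
  imports "HOL-Analysis.Analysis" "HOL-Library.Landau_Symbols"
begin

section \<open>FLaMECaST\<close>

text \<open>
  Sources and sinks are identified with their indices in the two position lists, so several
  of them may share a position. The list \<open>capacities\<close> is \<open>[c\<^sub>0, \<dots>, c\<^sub>\<lambda>\<^sub>+\<^sub>1]\<close>.
\<close>

record flamecast =
  source_pos :: "(real^2) list"
  sink_pos :: "(real^2) list"
  capacities :: "nat list"
  exponent :: real

definition num_sources :: "flamecast \<Rightarrow> nat" where
  "num_sources I = length (source_pos I)"

definition num_sinks :: "flamecast \<Rightarrow> nat" where
  "num_sinks I = length (sink_pos I)"

definition cap :: "flamecast \<Rightarrow> nat \<Rightarrow> nat" where
  "cap I i = capacities I ! i"

definition num_layers :: "flamecast \<Rightarrow> nat" where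
  "num_layers I = length (capacities I) - 2"

definition flamecast_instance :: "flamecast \<Rightarrow> bool" where
  "flamecast_instance I \<longleftrightarrow>
     length (capacities I) \<ge> 2 \<and>
     sorted_wrt (\<ge>) (capacities I) \<and>
     (\<forall>c \<in> set (capacities I). c \<ge> 1) \<and>
     0 \<le> exponent I \<and> exponent I \<le> 1"

datatype vertex = Source nat | Sink nat | Steiner nat

text \<open>An edge \<open>(u, v)\<close> is directed from the child \<open>u\<close> to its parent \<open>v\<close>.\<close>

record topology =
  verts :: "vertex set"
  edges :: "(vertex \<times> vertex) set"

definition rooted_forest :: "topology \<Rightarrow> bool" where
  "rooted_forest G \<longleftrightarrow>
     finite (verts G) \<and> edges G \<subseteq> verts G \<times> verts G \<and>
     single_valued (edges G) \<and> acyclic (edges G)"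

definition roots :: "topology \<Rightarrow> vertex set" where
  "roots G = verts G - Domain (edges G)"

definition leaves :: "topology \<Rightarrow> vertex set" where
  "leaves G = verts G - Range (edges G)"

definition layer :: "topology \<Rightarrow> vertex \<Rightarrow> nat" where
  "layer G v = (THE k. \<exists>r \<in> roots G. (v, r) \<in> edges G ^^ k)"

definition load :: "topology \<Rightarrow> vertex \<Rightarrow> nat" where
  "load G v = card {i. Source i \<in> verts G \<and> (Source i, v) \<in> (edges G)\<^sup>*}"

definition topology_for :: "flamecast \<Rightarrow> topology \<Rightarrow> bool" where
  "topology_for I G \<longleftrightarrow>
     rooted_forest G \<and>
     (\<forall>v \<in> verts G. layer G v \<le> num_layers I + 1) \<and>
     leaves G = Source ` {..<num_sources I} \<and>
     roots G \<subseteq> Sink ` {..<num_sinks I} \<and>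
     verts G - leaves G - roots G \<subseteq> range Steiner"

definition valid_topology :: "flamecast \<Rightarrow> topology \<Rightarrow> bool" where
  "valid_topology I G \<longleftrightarrow>
     topology_for I G \<and> (\<forall>v \<in> verts G. load G v \<le> cap I (layer G v))"

definition embedding_for :: "flamecast \<Rightarrow> topology \<Rightarrow> (vertex \<Rightarrow> real^2) \<Rightarrow> bool" where
  "embedding_for I G pos \<longleftrightarrow>
     (\<forall>i. Source i \<in> verts G \<longrightarrow> pos (Source i) = source_pos I ! i) \<and>
     (\<forall>j. Sink j \<in> verts G \<longrightarrow> pos (Sink j) = sink_pos I ! j)"

type_synonym layout = "topology \<times> (vertex \<Rightarrow> real^2)"

definition valid_layout :: "flamecast \<Rightarrow> layout \<Rightarrow> bool" where
  "valid_layout I L \<longleftrightarrow> valid_topology I (fst L) \<and> embedding_for I (fst L) (snd L)"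

definition layout_cost :: "flamecast \<Rightarrow> layout \<Rightarrow> real" where
  "layout_cost I L =
     (\<Sum>(u, v) \<in> edges (fst L).
        norm (snd L u - snd L v) * real (load (fst L) u) powr exponent I)"

definition min_cost_layout :: "flamecast \<Rightarrow> layout \<Rightarrow> bool" where
  "min_cost_layout I L \<longleftrightarrow>
     valid_layout I L \<and> (\<forall>L'. valid_layout I L' \<longrightarrow> layout_cost I L \<le> layout_cost I L')"

section \<open>Real random access machine\<close>

text \<open>
  Programs are structured real-RAM programs. Memory consists of named, unbounded arrays of
  natural numbers and of reals (a program mentions only finitely many names; a register is
  cell 0 of an array). Every elementary operation costs one unit: on reals these are the four
  arithmetic operations, square root and comparison; on naturals only addition, truncated
  subtraction and comparison, so unit cost does not permit repeated squaring of integers.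
  There is no rounding, hence no flow of data from reals to naturals except through comparisons.
\<close>

record state =
  nmem :: "string \<Rightarrow> nat \<Rightarrow> nat"
  rmem :: "string \<Rightarrow> nat \<Rightarrow> real"

datatype nexp =
    NConst nat
  | NCell string nexp
  | NAdd nexp nexp
  | NSub nexp nexp

datatype rexp =
    RConst int
  | RCell string nexp
  | RAdd rexp rexp
  | RSub rexp rexp
  | RMul rexp rexp
  | RDiv rexp rexp
  | RSqrt rexp

datatype bexp =
    NLess nexp nexp
  | RLess rexp rexp
  | BNot bexp
  | BAnd bexp bexp

datatype com =
    Skip
  | NAssign string nexp nexp
  | RAssign string nexp rexp
  | Seq com com
  | Cond bexp com com
  | While bexp com

primrec nval :: "nexp \<Rightarrow> state \<Rightarrow> nat" where
  "nval (NConst k) s = k"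
| "nval (NCell x a) s = nmem s x (nval a s)"
| "nval (NAdd a b) s = nval a s + nval b s"
| "nval (NSub a b) s = nval a s - nval b s"

primrec rval :: "rexp \<Rightarrow> state \<Rightarrow> real" where
  "rval (RConst k) s = of_int k"
| "rval (RCell x a) s = rmem s x (nval a s)"
| "rval (RAdd a b) s = rval a s + rval b s"
| "rval (RSub a b) s = rval a s - rval b s"
| "rval (RMul a b) s = rval a s * rval b s"
| "rval (RDiv a b) s = rval a s / rval b s"
| "rval (RSqrt a) s = sqrt (rval a s)"

primrec bval :: "bexp \<Rightarrow> state \<Rightarrow> bool" where
  "bval (NLess a b) s \<longleftrightarrow> nval a s < nval b s"
| "bval (RLess a b) s \<longleftrightarrow> rval a s < rval b s"
| "bval (BNot b) s \<longleftrightarrow> \<not> bval b s"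
| "bval (BAnd a b) s \<longleftrightarrow> bval a s \<and> bval b s"

primrec ntime :: "nexp \<Rightarrow> nat" where
  "ntime (NConst k) = 1"
| "ntime (NCell x a) = ntime a + 1"
| "ntime (NAdd a b) = ntime a + ntime b + 1"
| "ntime (NSub a b) = ntime a + ntime b + 1"

primrec rtime :: "rexp \<Rightarrow> nat" where
  "rtime (RConst k) = 1"
| "rtime (RCell x a) = ntime a + 1"
| "rtime (RAdd a b) = rtime a + rtime b + 1"
| "rtime (RSub a b) = rtime a + rtime b + 1"
| "rtime (RMul a b) = rtime a + rtime b + 1"
| "rtime (RDiv a b) = rtime a + rtime b + 1"
| "rtime (RSqrt a) = rtime a + 1"

primrec btime :: "bexp \<Rightarrow> nat" where
  "btime (NLess a b) = ntime a + ntime b + 1"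
| "btime (RLess a b) = rtime a + rtime b + 1"
| "btime (BNot b) = btime b + 1"
| "btime (BAnd a b) = btime a + btime b + 1"

definition nupdate :: "string \<Rightarrow> nat \<Rightarrow> nat \<Rightarrow> state \<Rightarrow> state" where
  "nupdate x i k s = s\<lparr>nmem := (nmem s)(x := (nmem s x)(i := k))\<rparr>"

definition rupdate :: "string \<Rightarrow> nat \<Rightarrow> real \<Rightarrow> state \<Rightarrow> state" where
  "rupdate x i r s = s\<lparr>rmem := (rmem s)(x := (rmem s x)(i := r))\<rparr>"

text \<open>\<open>runs c s t s'\<close>: started in \<open>s\<close>, the program \<open>c\<close> halts in \<open>s'\<close> after \<open>t\<close> steps.\<close>

inductive runs :: "com \<Rightarrow> state \<Rightarrow> nat \<Rightarrow> state \<Rightarrow> bool" where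
  Skip: "runs Skip s 1 s"
| NAssign: "runs (NAssign x a e) s (ntime a + ntime e + 1)
     (nupdate x (nval a s) (nval e s) s)"
| RAssign: "runs (RAssign x a e) s (ntime a + rtime e + 1)
     (rupdate x (nval a s) (rval e s) s)"
| Seq: "runs c1 s t1 s1 \<Longrightarrow> runs c2 s1 t2 s2 \<Longrightarrow> runs (Seq c1 c2) s (t1 + t2) s2"
| CondTrue: "bval b s \<Longrightarrow> runs c1 s t s' \<Longrightarrow> runs (Cond b c1 c2) s (btime b + t + 1) s'"
| CondFalse: "\<not> bval b s \<Longrightarrow> runs c2 s t s' \<Longrightarrow> runs (Cond b c1 c2) s (btime b + t + 1) s'"
| WhileFalse: "\<not> bval b s \<Longrightarrow> runs (While b c) s (btime b + 1) s"
| WhileTrue: "bval b s \<Longrightarrow> runs c s t1 s1 \<Longrightarrow> runs (While b c) s1 t2 s2 \<Longrightarrow>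
     runs (While b c) s (btime b + t1 + t2 + 1) s2"

lemma runs_deterministic:
  "runs c s t s' \<Longrightarrow> runs c s u s'' \<Longrightarrow> u = t \<and> s'' = s'"
proof (induction arbitrary: u s'' rule: runs.induct)
  case (WhileTrue b s c t1 s1 t2 s2)
  from WhileTrue.prems WhileTrue.hyps show ?case
    by (cases rule: runs.cases) (auto dest: WhileTrue.IH)
next
  case (Seq c1 s t1 s1 c2 t2 s2)
  from Seq.prems show ?case
    by (cases rule: runs.cases) (auto dest: Seq.IH)
qed (erule runs.cases; force)+

section \<open>Solving FLaMECaST on the real RAM\<close>

text \<open>The instance is in memory when the program starts; all other cells are 0.\<close>

definition nat_array :: "nat list \<Rightarrow> nat \<Rightarrow> nat" where
  "nat_array xs i = (if i < length xs then xs ! i else 0)"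

definition real_array :: "real list \<Rightarrow> nat \<Rightarrow> real" where
  "real_array xs i = (if i < length xs then xs ! i else 0)"

definition input_state :: "flamecast \<Rightarrow> state" where
  "input_state I =
     \<lparr>nmem = (\<lambda>_ _. 0)
        (''num_sources'' := nat_array [num_sources I],
         ''num_sinks'' := nat_array [num_sinks I],
         ''num_layers'' := nat_array [num_layers I],
         ''capacities'' := nat_array (capacities I)),
      rmem = (\<lambda>_ _. 0)
        (''source_x'' := real_array (map (\<lambda>p. p $ 1) (source_pos I)),
         ''source_y'' := real_array (map (\<lambda>p. p $ 2) (source_pos I)),
         ''sink_x'' := real_array (map (\<lambda>p. p $ 1) (sink_pos I)),
         ''sink_y'' := real_array (map (\<lambda>p. p $ 2) (sink_pos I)),
         ''exponent'' := real_array [exponent I])\<rparr>"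

text \<open>
  A layout with \<open>k\<close> Steiner vertices is output as \<open>k\<close>, the parents of the \<open>n\<close> sources (cells
  \<open>0, \<dots>, n - 1\<close> of array \<open>parent\<close>) and of the Steiner vertices (cells \<open>n, \<dots>, n + k - 1\<close>), and the
  coordinates of the Steiner vertices. A parent is coded by \<open>j\<close> if it is the \<open>j\<close>-th sink and by
  \<open>num_sinks + q\<close> if it is the \<open>q\<close>-th Steiner vertex. A topology has no isolated vertices (these
  would be both sources and sinks), so its vertex set is the field of its edge relation.
\<close>

definition output_parent :: "flamecast \<Rightarrow> state \<Rightarrow> nat \<Rightarrow> vertex" where
  "output_parent I s i =
     (let p = nmem s ''parent'' i
      in if p < num_sinks I then Sink p else Steiner (p - num_sinks I))"

definition output_edges :: "flamecast \<Rightarrow> state \<Rightarrow> (vertex \<times> vertex) set" where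
  "output_edges I s =
     {(Source i, output_parent I s i) | i. i < num_sources I} \<union>
     {(Steiner q, output_parent I s (num_sources I + q)) | q. q < nmem s ''num_steiner'' 0}"

definition output_pos :: "flamecast \<Rightarrow> state \<Rightarrow> vertex \<Rightarrow> real^2" where
  "output_pos I s v =
     (case v of
        Source i \<Rightarrow> source_pos I ! i
      | Sink j \<Rightarrow> sink_pos I ! j
      | Steiner q \<Rightarrow> vector [rmem s ''steiner_x'' q, rmem s ''steiner_y'' q])"

definition output_layout :: "flamecast \<Rightarrow> state \<Rightarrow> layout" where
  "output_layout I s =
     (\<lparr>verts = Field (output_edges I s), edges = output_edges I s\<rparr>, output_pos I s)"

definition correct_output :: "flamecast \<Rightarrow> state \<Rightarrow> bool" where
  "correct_output I s \<longleftrightarrow>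
     (if \<exists>L. valid_layout I L
      then nmem s ''feasible'' 0 = 1 \<and> min_cost_layout I (output_layout I s)
      else nmem s ''feasible'' 0 = 0)"

end

theory Submission
  imports Defs
begin

text \<open>
  Connecting every source directly to a sink is always optimal. For exponent 1 the cost of a
  layout is the total length of the source-to-root paths, which by the triangle inequality is at
  least the total distance between the sources and their roots; without intermediate layers
  every source is a child of its root anyway. What remains is the assignment problem between the
  sources and \<open>c\<^sub>0\<close> slots for each sink. It is solved by the Hungarian method: rows are inserted
  one at a time, each along a shortest augmenting path found in quadratic time by Dijkstra's
  algorithm on the reduced costs. Optimality follows from linear programming duality.
\<close>

section \<open>Reasoning about real-RAM programs\<close>

text \<open>The bound speaks only of \<open>N = c0 * |T|\<close>, so the number of sources must not
  enter it. If it exceeds \<open>N\<close>, no assignment exists, and the program stops after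
  comparing it with the number of slots. Otherwise there are at most \<open>N\<close> rows, each
  insertion scans at most \<open>N + 1\<close> columns (the virtual one included), and each scan is
  a pass over all columns. The machine shapes the rest. It can neither multiply nor divide naturals,
  so slots are counted out one by one and the sink of each slot is stored in a table. It has no
  infinite real, so slacks are not initialised: the first scan of an insertion overwrites them.
  Potentials are adjusted after every scan, so a tentative distance is simply a least reduced cost,
  and the column to scan next has slack 0. The method itself is treated on plain functions for
  matching, potentials and search tree; the program proofs only identify these with arrays. The
  lower capacities never obstruct a direct layout, since each source has load 1 and all capacities
  are at least 1.\<close>

primrec loop_free :: "com \<Rightarrow> bool" where
  "loop_free Skip \<longleftrightarrow> True"
| "loop_free (NAssign x a e) \<longleftrightarrow> True"
| "loop_free (RAssign x a e) \<longleftrightarrow> True"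
| "loop_free (Seq c1 c2) \<longleftrightarrow> loop_free c1 \<and> loop_free c2"
| "loop_free (Cond b c1 c2) \<longleftrightarrow> loop_free c1 \<and> loop_free c2"
| "loop_free (While b c) \<longleftrightarrow> False"

text \<open>The values for loops in \<open>exec\<close> and \<open>exec_time\<close> are junk: both are meant for loop-free programs.\<close>

primrec exec :: "com \<Rightarrow> state \<Rightarrow> state" where
  "exec Skip s = s"
| "exec (NAssign x a e) s = nupdate x (nval a s) (nval e s) s"
| "exec (RAssign x a e) s = rupdate x (nval a s) (rval e s) s"
| "exec (Seq c1 c2) s = exec c2 (exec c1 s)"
| "exec (Cond b c1 c2) s = (if bval b s then exec c1 s else exec c2 s)"
| "exec (While b c) s = s"

primrec exec_time :: "com \<Rightarrow> nat" where
  "exec_time Skip = 1"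
| "exec_time (NAssign x a e) = ntime a + ntime e + 1"
| "exec_time (RAssign x a e) = ntime a + rtime e + 1"
| "exec_time (Seq c1 c2) = exec_time c1 + exec_time c2"
| "exec_time (Cond b c1 c2) = btime b + max (exec_time c1) (exec_time c2) + 1"
| "exec_time (While b c) = 0"

text \<open>The branches of a conditional may cost differently and \<open>exec_time\<close> charges
  the larger one, so it bounds the running time without being equal to it.\<close>

lemma runs_exec:
  "loop_free c \<Longrightarrow> \<exists>t \<le> exec_time c. runs c s t (exec c s)"
proof (induction c arbitrary: s)
  case (Seq c1 c2)
  obtain t1 where t1: "t1 \<le> exec_time c1" "runs c1 s t1 (exec c1 s)"
    using Seq by auto
  obtain t2 where t2: "t2 \<le> exec_time c2" "runs c2 (exec c1 s) t2 (exec c2 (exec c1 s))"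
    using Seq by fastforce
  show ?case
    using runs.Seq[OF t1(2) t2(2)] t1(1) t2(1) by (auto intro!: exI[of _ "t1 + t2"])
next
  case (Cond b c1 c2)
  obtain t1 where t1: "t1 \<le> exec_time c1" "runs c1 s t1 (exec c1 s)"
    using Cond by auto
  obtain t2 where t2: "t2 \<le> exec_time c2" "runs c2 s t2 (exec c2 s)"
    using Cond by fastforce
  show ?case
  proof (cases "bval b s")
    case True
    then show ?thesis
      using runs.CondTrue[OF True t1(2)] t1(1) by (intro exI[of _ "btime b + t1 + 1"]) simp
  next
    case False
    then show ?thesis
      using runs.CondFalse[OF False t2(2)] t2(1) by (intro exI[of _ "btime b + t2 + 1"]) simp
  qed
next
  case (NAssign x a e)
  show ?case
    using runs.NAssign[of x a e s] by auto
next
  case (RAssign x a e)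
  show ?case
    using runs.RAssign[of x a e s] by auto
next
  case Skip
  show ?case
    using runs.Skip[of s] by auto
qed simp

section \<open>Frame conditions and timed total correctness\<close>

primrec nwrites :: "com \<Rightarrow> string set" where
  "nwrites Skip = {}"
| "nwrites (NAssign x a e) = {x}"
| "nwrites (RAssign x a e) = {}"
| "nwrites (Seq c1 c2) = nwrites c1 \<union> nwrites c2"
| "nwrites (Cond b c1 c2) = nwrites c1 \<union> nwrites c2"
| "nwrites (While b c) = nwrites c"

primrec rwrites :: "com \<Rightarrow> string set" where
  "rwrites Skip = {}"
| "rwrites (NAssign x a e) = {}"
| "rwrites (RAssign x a e) = {x}"
| "rwrites (Seq c1 c2) = rwrites c1 \<union> rwrites c2"
| "rwrites (Cond b c1 c2) = rwrites c1 \<union> rwrites c2"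
| "rwrites (While b c) = rwrites c"

text \<open>The frame condition between two states: \<open>A\<close> and \<open>B\<close> name the
  natural and real arrays that may differ. Taken with the write sets of a program it carries every
  untouched array through a run, so invariants need not mention those arrays.\<close>

definition agree :: "string set \<Rightarrow> string set \<Rightarrow> state \<Rightarrow> state \<Rightarrow> bool" where
  "agree A B s s' \<longleftrightarrow>
     (\<forall>x. x \<notin> A \<longrightarrow> nmem s' x = nmem s x) \<and> (\<forall>x. x \<notin> B \<longrightarrow> rmem s' x = rmem s x)"

lemma agree_refl: "agree A B s s"
  by (simp add: agree_def)

lemma agree_trans: "agree A B s s' \<Longrightarrow> agree A B s' s'' \<Longrightarrow> agree A B s s''"
  by (simp add: agree_def)

lemma agree_nmem: "agree A B s s' \<Longrightarrow> x \<notin> A \<Longrightarrow> nmem s' x = nmem s x"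
  by (simp add: agree_def)

lemma agree_rmem: "agree A B s s' \<Longrightarrow> x \<notin> B \<Longrightarrow> rmem s' x = rmem s x"
  by (simp add: agree_def)

lemma nmem_nupdate [simp]:
  "nmem (nupdate x i k s) y j = (if y = x \<and> j = i then k else nmem s y j)"
  by (simp add: nupdate_def)

lemma rmem_nupdate [simp]: "rmem (nupdate x i k s) = rmem s"
  by (simp add: nupdate_def)

lemma rmem_rupdate [simp]:
  "rmem (rupdate x i k s) y j = (if y = x \<and> j = i then k else rmem s y j)"
  by (simp add: rupdate_def)

lemma nmem_rupdate [simp]: "nmem (rupdate x i k s) = nmem s"
  by (simp add: rupdate_def)

lemma nmem_nupdate_other [simp]: "y \<noteq> x \<Longrightarrow> nmem (nupdate x i k s) y = nmem s y"
  by (simp add: nupdate_def)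

lemma rmem_rupdate_other [simp]: "y \<noteq> x \<Longrightarrow> rmem (rupdate x i r s) y = rmem s y"
  by (simp add: rupdate_def)

lemma runs_agree: "runs c s t s' \<Longrightarrow> agree (nwrites c) (rwrites c) s s'"
  by (induction rule: runs.induct) (auto simp: agree_def fun_eq_iff)

text \<open>A total-correctness triple with a time budget. By determinism of \<open>runs\<close> the
  run it asserts is the only one.\<close>

definition halts :: "com \<Rightarrow> state \<Rightarrow> nat \<Rightarrow> (state \<Rightarrow> bool) \<Rightarrow> bool" where
  "halts c s T Q \<longleftrightarrow> (\<exists>t s'. runs c s t s' \<and> t \<le> T \<and> Q s')"

text \<open>The consequence rule; the frame condition of the run is available when the postcondition
  is weakened.\<close>

lemma halts_mono:
  "halts c s T Q \<Longrightarrow> T \<le> T' \<Longrightarrow> (\<And>s'. agree (nwrites c) (rwrites c) s s' \<Longrightarrow> Q s' \<Longrightarrow> Q' s')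
    \<Longrightarrow> halts c s T' Q'"
  unfolding halts_def by (meson le_trans runs_agree)

lemma halts_exec: "loop_free c \<Longrightarrow> exec_time c \<le> T \<Longrightarrow> Q (exec c s) \<Longrightarrow> halts c s T Q"
  unfolding halts_def using runs_exec[of c s] by (meson le_trans)

lemma halts_Seq:
  assumes "halts c1 s T1 P"
    and "\<And>s'. agree (nwrites c1) (rwrites c1) s s' \<Longrightarrow> P s' \<Longrightarrow> halts c2 s' T2 Q"
  shows "halts (Seq c1 c2) s (T1 + T2) Q"
proof -
  obtain t1 s1 where 1: "runs c1 s t1 s1" "t1 \<le> T1" "P s1"
    using assms(1) by (auto simp: halts_def)
  obtain t2 s2 where 2: "runs c2 s1 t2 s2" "t2 \<le> T2" "Q s2"
    using assms(2)[OF runs_agree[OF 1(1)] 1(3)] by (auto simp: halts_def)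
  show ?thesis
    unfolding halts_def using runs.Seq[OF 1(1) 2(1)] 1 2 by (metis add_mono)
qed

lemma halts_Cond:
  assumes "bval b s \<Longrightarrow> halts c1 s T Q" "\<not> bval b s \<Longrightarrow> halts c2 s T Q"
  shows "halts (Cond b c1 c2) s (btime b + T + 1) Q"
proof (cases "bval b s")
  case True
  then show ?thesis
    using assms(1) runs.CondTrue[OF True] unfolding halts_def by (meson add_le_mono le_refl)
next
  case False
  then show ?thesis
    using assms(2) runs.CondFalse[OF False] unfolding halts_def by (meson add_le_mono le_refl)
qed

text \<open>The measure \<open>m\<close> bounds the number of remaining iterations: each pays for
  the body and its test, and one last failing test remains. The step may use the frame relative to
  the state before the whole loop, which is why the induction ranges over the states that agree with
  \<open>s\<close>.\<close>

lemma halts_While: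
  assumes "Inv s"
    and step: "\<And>s'. \<lbrakk>Inv s'; agree (nwrites c) (rwrites c) s s'; bval b s'\<rbrakk>
      \<Longrightarrow> halts c s' B (\<lambda>s''. Inv s'' \<and> m s'' < m s')"
  shows "halts (While b c) s (m s * (B + btime b + 1) + btime b + 1)
           (\<lambda>s'. Inv s' \<and> \<not> bval b s')"
proof -
  have "halts (While b c) s' (m s' * (B + btime b + 1) + btime b + 1)
           (\<lambda>s'. Inv s' \<and> \<not> bval b s')"
    if "Inv s'" "agree (nwrites c) (rwrites c) s s'" for s'
    using that
  proof (induction "m s'" arbitrary: s' rule: less_induct)
    case less
    show ?case
    proof (cases "bval b s'")
      case True
      obtain t1 s1 where 1: "runs c s' t1 s1" "t1 \<le> B" "Inv s1" "m s1 < m s'"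
        using step[OF less.prems True] by (auto simp: halts_def)
      obtain t2 s2 where 2: "runs (While b c) s1 t2 s2"
          "t2 \<le> m s1 * (B + btime b + 1) + btime b + 1" "Inv s2 \<and> \<not> bval b s2"
        using less.hyps[OF 1(4,3) agree_trans[OF less.prems(2) runs_agree[OF 1(1)]]]
        by (auto simp: halts_def)
      have "Suc (m s1) * (B + btime b + 1) \<le> m s' * (B + btime b + 1)"
        using 1(4) by (intro mult_right_mono) auto
      then have "btime b + t1 + t2 + 1 \<le> m s' * (B + btime b + 1) + btime b + 1"
        using 1(2) 2(2) by simp
      then show ?thesis
        unfolding halts_def using runs.WhileTrue[OF True 1(1) 2(1)] 2(3) by blast
    next
      case False
      then show ?thesis
        unfolding halts_def using runs.WhileFalse[OF False, of c] less.prems(1)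
        by (intro exI[of _ "btime b + 1"] exI[of _ s']) auto
    qed
  qed
  then show ?thesis
    using assms(1) agree_refl by blast
qed

section \<open>Registers and counting loops\<close>

abbreviation nreg :: "string \<Rightarrow> nexp" where "nreg x \<equiv> NCell x (NConst 0)"
abbreviation rreg :: "string \<Rightarrow> rexp" where "rreg x \<equiv> RCell x (NConst 0)"
abbreviation nset :: "string \<Rightarrow> nexp \<Rightarrow> com" where "nset x \<equiv> NAssign x (NConst 0)"
abbreviation rset :: "string \<Rightarrow> rexp \<Rightarrow> com" where "rset x \<equiv> RAssign x (NConst 0)"
abbreviation ninc :: "string \<Rightarrow> com" where "ninc x \<equiv> nset x (NAdd (nreg x) (NConst 1))"
abbreviation BOr :: "bexp \<Rightarrow> bexp \<Rightarrow> bexp" where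
  "BOr a b \<equiv> BNot (BAnd (BNot a) (BNot b))"
abbreviation seq_op (infixr ";;" 60) where "c1 ;; c2 \<equiv> Seq c1 c2"

text \<open>The counter is not initialised, so a loop can start at column 0, at column 1, or rely on
  memory being zero.\<close>

definition for_loop :: "string \<Rightarrow> nexp \<Rightarrow> com \<Rightarrow> com" where
  "for_loop x b c = While (NLess (nreg x) b) (c ;; ninc x)"

lemma writes_for_loop [simp]:
  "nwrites (for_loop x b c) = insert x (nwrites c)"
  "rwrites (for_loop x b c) = rwrites c"
  by (auto simp: for_loop_def)

text \<open>\<open>Inv k\<close> describes the state in which the counter has value
  \<open>k\<close>. The increment follows the body, hence the step establishes the invariant for the
  state with the counter already raised. Of the 10 extra steps per iteration, 6 pay for the
  increment and 4 belong to the test.\<close>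

lemma halts_for_loop:
  assumes "nmem s x 0 = a" "a \<le> m" "Inv a s"
    and bound: "\<And>k s'. \<lbrakk>Inv k s'; agree (insert x (nwrites c)) (rwrites c) s s'\<rbrakk> \<Longrightarrow> nval b s' = m"
    and step: "\<And>k s'. \<lbrakk>a \<le> k; k < m; nmem s' x 0 = k; Inv k s';
        agree (insert x (nwrites c)) (rwrites c) s s'\<rbrakk>
      \<Longrightarrow> halts c s' B (\<lambda>s''. nmem s'' x 0 = k \<and> Inv (Suc k) (nupdate x 0 (Suc k) s''))"
  shows "halts (for_loop x b c) s ((m - a) * (B + ntime b + 10) + ntime b + 4) (Inv m)"
proof -
  let ?J = "\<lambda>s'. a \<le> nmem s' x 0 \<and> nmem s' x 0 \<le> m \<and> Inv (nmem s' x 0) s'"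
  have "halts (for_loop x b c) s
     ((m - nmem s x 0) * ((B + 6) + btime (NLess (nreg x) b) + 1) + btime (NLess (nreg x) b) + 1)
     (\<lambda>s'. ?J s' \<and> \<not> bval (NLess (nreg x) b) s')"
    unfolding for_loop_def
  proof (rule halts_While)
    show "?J s"
      using assms(1-3) by simp
  next
    fix s' assume J: "?J s'" and b: "bval (NLess (nreg x) b) s'"
      and "agree (nwrites (c ;; ninc x)) (rwrites (c ;; ninc x)) s s'"
    then have ag: "agree (insert x (nwrites c)) (rwrites c) s s'"
      by simp
    let ?k = "nmem s' x 0"
    have k: "?k < m"
      using b bound[OF _ ag] J by auto
    show "halts (c ;; ninc x) s' (B + 6) (\<lambda>s''. ?J s'' \<and> m - nmem s'' x 0 < m - nmem s' x 0)"
    proof (rule halts_Seq[OF step[OF _ k _ _ ag]])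
      fix s'' assume "nmem s'' x 0 = ?k \<and> Inv (Suc ?k) (nupdate x 0 (Suc ?k) s'')"
      then show "halts (ninc x) s'' 6 (\<lambda>s''. ?J s'' \<and> m - nmem s'' x 0 < m - nmem s' x 0)"
        using J k by (intro halts_exec) auto
    qed (use J in auto)
  qed
  then show ?thesis
  proof (rule halts_mono)
    show "(m - nmem s x 0) * ((B + 6) + btime (NLess (nreg x) b) + 1) + btime (NLess (nreg x) b) + 1
      \<le> (m - a) * (B + ntime b + 10) + ntime b + 4"
      using assms(1) by (simp add: algebra_simps)
  next
    fix s' assume "agree (nwrites (for_loop x b c)) (rwrites (for_loop x b c)) s s'"
      and J: "?J s' \<and> \<not> bval (NLess (nreg x) b) s'"
    then have "nval b s' = m"
      using bound by auto
    then show "Inv m s'"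
      using J by (cases "nmem s' x 0 = m") auto
  qed
qed

section \<open>Direct layouts\<close>

definition assignment :: "flamecast \<Rightarrow> (nat \<Rightarrow> nat) \<Rightarrow> bool" where
  "assignment I f \<longleftrightarrow>
     (\<forall>i < num_sources I. f i < num_sinks I) \<and>
     (\<forall>j. card {i. i < num_sources I \<and> f i = j} \<le> cap I 0)"

definition assignment_cost :: "flamecast \<Rightarrow> (nat \<Rightarrow> nat) \<Rightarrow> real" where
  "assignment_cost I f = (\<Sum>i < num_sources I. norm (source_pos I ! i - sink_pos I ! f i))"

text \<open>Along a single-valued relation all paths from \<open>v\<close> visit the same vertices,
  and \<open>r\<close> and \<open>r'\<close> can only be where they stop. This makes the description
  of \<open>layer\<close> by \<open>THE\<close> meaningful.\<close>

lemma relpow_to_sink_unique: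
  assumes "single_valued E" "(v, r) \<in> E ^^ k" "(v, r') \<in> E ^^ k'"
    and "r \<notin> Domain E" "r' \<notin> Domain E"
  shows "k = k'"
  using assms(2,3)
proof (induction k arbitrary: v k')
  case 0
  then show ?case
    using assms(4) by (cases k') (use relpow_Suc_D2 in fastforce)+
next
  case (Suc k)
  obtain y where y: "(v, y) \<in> E" "(y, r) \<in> E ^^ k"
    using Suc.prems(1) relpow_Suc_D2 by metis
  show ?case
  proof (cases k')
    case 0
    then show ?thesis
      using Suc.prems(2) y(1) assms(5) by auto
  next
    case (Suc l)
    then obtain y' where "(v, y') \<in> E" "(y', r') \<in> E ^^ l"
      using Suc.prems(2) relpow_Suc_D2 by metis
    moreover have "y' = y"
      using y(1) \<open>(v, y') \<in> E\<close> assms(1) by (auto dest: single_valuedD)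
    ultimately show ?thesis
      using Suc Suc.IH[OF y(2)] by auto
  qed
qed

lemma layer_eqI:
  assumes "rooted_forest G" "r \<in> roots G" "(v, r) \<in> edges G ^^ k"
  shows "layer G v = k"
  unfolding layer_def
proof (rule the_equality)
  show "\<exists>r\<in>roots G. (v, r) \<in> edges G ^^ k"
    using assms by auto
next
  fix k' assume "\<exists>r\<in>roots G. (v, r) \<in> edges G ^^ k'"
  then show "k' = k"
    using relpow_to_sink_unique[of "edges G" v _ k' r k] assms
    by (auto simp: rooted_forest_def roots_def)
qed

text \<open>Following parents terminates, because the converse of a finite acyclic relation is
  well-founded.\<close>

lemma root_exists:
  assumes "rooted_forest G" "v \<in> verts G"
  shows "\<exists>r \<in> roots G. (v, r) \<in> (edges G)\<^sup>*"
proof -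
  have fin: "finite (edges G)"
    using assms(1) by (auto simp: rooted_forest_def intro: finite_subset)
  have "wf ((edges G)\<inverse>)"
    using assms(1) fin by (auto simp: rooted_forest_def intro: finite_acyclic_wf_converse)
  then show ?thesis
    using assms(2)
  proof (induction v rule: wf_induct_rule)
    case (less v)
    show ?case
    proof (cases "v \<in> Domain (edges G)")
      case True
      then obtain y where y: "(v, y) \<in> edges G"
        by auto
      then have "y \<in> verts G"
        using assms(1) by (auto simp: rooted_forest_def)
      then obtain r where "r \<in> roots G" "(y, r) \<in> (edges G)\<^sup>*"
        using less.IH y by auto
      then show ?thesis
        using y by (auto intro: converse_rtrancl_into_rtrancl)
    next
      case False
      then show ?thesis
        using less.prems by (auto simp: roots_def)
    qed
  qed
qed

text \<open>In a forest, the edges whose tail is reachable from \<open>x\<close> form exactly the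
  path from \<open>x\<close> to its root. Describing the path as such a set, not as a list, allows
  the later exchange of summation over sources and edges.\<close>

lemma norm_le_path_length:
  fixes pos :: "vertex \<Rightarrow> real^2"
  assumes "(x, r) \<in> E\<^sup>*" "finite E" "acyclic E"
  shows "norm (pos x - pos r) \<le> (\<Sum>(u, v) \<in> {e \<in> E. (x, fst e) \<in> E\<^sup>*}. norm (pos u - pos v))"
  using assms(1)
proof (induction rule: converse_rtrancl_induct)
  case base
  then show ?case
    by (auto intro: sum_nonneg)
next
  case (step x y)
  let ?A = "\<lambda>z. {e \<in> E. (z, fst e) \<in> E\<^sup>*}"
  \<comment> \<open>Acyclicity makes the first edge new, so inserting it into the set of later edges
    adds its full length.\<close>
  have notin: "(x, y) \<notin> ?A y"
    using step.hyps(1) assms(3) by (auto simp: acyclic_def dest: rtrancl_into_trancl2)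
  have "norm (pos x - pos r) \<le> norm (pos x - pos y) + norm (pos y - pos r)"
    using norm_triangle_ineq[of "pos x - pos y" "pos y - pos r"] by simp
  also have "\<dots> \<le> (\<Sum>(u, v) \<in> insert (x, y) (?A y). norm (pos u - pos v))"
    using step.IH notin assms(2) by simp
  also have "\<dots> \<le> (\<Sum>(u, v) \<in> ?A x. norm (pos u - pos v))"
    using step.hyps(1) assms(2)
    by (intro sum_mono2) (auto intro: converse_rtrancl_into_rtrancl)
  finally show ?case .
qed

section \<open>From layouts to assignments\<close>

locale feasible_layout =
  fixes I :: flamecast and G :: topology and pos :: "vertex \<Rightarrow> real^2"
  assumes inst: "flamecast_instance I" and valid: "valid_layout I (G, pos)"
begin

lemma forest: "rooted_forest G"
  using valid by (simp add: valid_layout_def valid_topology_def topology_for_def)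

lemma fin: "finite (verts G)" "finite (edges G)"
  using forest by (auto simp: rooted_forest_def intro: finite_subset)

lemma leaves_eq: "leaves G = Source ` {..<num_sources I}"
  using valid by (simp add: valid_layout_def valid_topology_def topology_for_def)

lemma roots_sub: "roots G \<subseteq> Sink ` {..<num_sinks I}"
  using valid by (simp add: valid_layout_def valid_topology_def topology_for_def)

text \<open>Inner vertices are Steiner vertices and roots are sinks, so a source vertex can only be
  a leaf. This settles which indices \<open>load\<close> counts.\<close>

lemma source_in_verts: "Source i \<in> verts G \<longleftrightarrow> i < num_sources I"
proof
  assume *: "Source i \<in> verts G"
  have "verts G - leaves G - roots G \<subseteq> range Steiner"
    using valid unfolding valid_layout_def valid_topology_def topology_for_def fst_conv by blast
  then have "Source i \<in> leaves G \<union> roots G"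
    using * by auto
  then show "i < num_sources I"
    using leaves_eq roots_sub by auto
next
  assume "i < num_sources I"
  then have "Source i \<in> leaves G"
    using leaves_eq by auto
  then show "Source i \<in> verts G"
    by (simp add: leaves_def)
qed

definition target :: "nat \<Rightarrow> nat" where
  "target i = (SOME j. Sink j \<in> roots G \<and> (Source i, Sink j) \<in> (edges G)\<^sup>*)"

lemma target:
  assumes "i < num_sources I"
  shows "Sink (target i) \<in> roots G" "(Source i, Sink (target i)) \<in> (edges G)\<^sup>*"
proof -
  have "\<exists>j. Sink j \<in> roots G \<and> (Source i, Sink j) \<in> (edges G)\<^sup>*"
    using root_exists[OF forest, of "Source i"] source_in_verts assms roots_sub by blast
  then have "Sink (target i) \<in> roots G \<and> (Source i, Sink (target i)) \<in> (edges G)\<^sup>*"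
    unfolding target_def by (rule someI_ex)
  then show "Sink (target i) \<in> roots G" "(Source i, Sink (target i)) \<in> (edges G)\<^sup>*"
    by auto
qed

text \<open>The sources sent to a root all lie in its subtree, and a root is in layer 0, where
  \<open>c0\<close> bounds the load.\<close>

lemma assignment_target: "assignment I target"
  unfolding assignment_def
proof (intro conjI allI impI)
  fix i assume "i < num_sources I"
  then show "target i < num_sinks I"
    using target(1) roots_sub by auto
next
  fix j
  show "card {i. i < num_sources I \<and> target i = j} \<le> cap I 0"
  \<comment> \<open>If no source is sent to \<open>j\<close>, then \<open>Sink j\<close> need not be
    a vertex, and validity says nothing about it.\<close>
  proof (cases "{i. i < num_sources I \<and> target i = j} = {}")
    case False
    then have root: "Sink j \<in> roots G"
      using target(1) by auto
    have "card {i. i < num_sources I \<and> target i = j} \<le> load G (Sink j)"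
      unfolding load_def
    proof (rule card_mono)
      show "finite {i. Source i \<in> verts G \<and> (Source i, Sink j) \<in> (edges G)\<^sup>*}"
        by (rule finite_subset[of _ "{..<num_sources I}"]) (auto simp: source_in_verts)
    qed (use target(2) source_in_verts in auto)
    also have "\<dots> \<le> cap I (layer G (Sink j))"
      using valid root by (auto simp: valid_layout_def valid_topology_def roots_def)
    also have "layer G (Sink j) = 0"
      by (rule layer_eqI[OF forest root]) simp
    finally show ?thesis .
  qed (simp only: card.empty le0)
qed

lemma pos_source: "i < num_sources I \<Longrightarrow> pos (Source i) = source_pos I ! i"
  using valid source_in_verts by (simp add: valid_layout_def embedding_for_def)

lemma pos_target: "i < num_sources I \<Longrightarrow> pos (Sink (target i)) = sink_pos I ! target i"
  using valid target(1) by (simp add: valid_layout_def embedding_for_def roots_def)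

lemma assignment_cost_target:
  "assignment_cost I target = (\<Sum>i < num_sources I. norm (pos (Source i) - pos (Sink (target i))))"
  by (simp add: assignment_cost_def pos_source pos_target)

text \<open>For exponent 1 the cost of a layout is the total length of the source-to-root paths.\<close>

lemma assignment_cost_target_le_linear:
  assumes "exponent I = 1"
  shows "assignment_cost I target \<le> layout_cost I (G, pos)"
proof -
  let ?n = "num_sources I" and ?E = "edges G"
  let ?w = "\<lambda>e. norm (pos (fst e) - pos (snd e))"
  let ?reach = "\<lambda>i e. (Source i, fst e) \<in> ?E\<^sup>*"
  have load: "real (load G u) = (\<Sum>i < ?n. of_bool ((Source i, u) \<in> ?E\<^sup>*))" for u
  proof -
    have "{i. Source i \<in> verts G \<and> (Source i, u) \<in> ?E\<^sup>*} = {i \<in> {..<?n}. (Source i, u) \<in> ?E\<^sup>*}"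
      by (auto simp: source_in_verts)
    moreover have "{i. i < ?n \<and> (Source i, u) \<in> ?E\<^sup>*} = {..<?n} \<inter> {i. (Source i, u) \<in> ?E\<^sup>*}"
      by auto
    ultimately show ?thesis
      by (simp add: load_def)
  qed
  have "assignment_cost I target \<le> (\<Sum>i < ?n. \<Sum>e \<in> {e \<in> ?E. ?reach i e}. ?w e)"
    unfolding assignment_cost_target
  proof (rule sum_mono)
    fix i assume "i \<in> {..<?n}"
    then show "norm (pos (Source i) - pos (Sink (target i))) \<le> (\<Sum>e \<in> {e \<in> ?E. ?reach i e}. ?w e)"
      using norm_le_path_length[OF target(2), of i pos] fin forest
      by (simp add: rooted_forest_def case_prod_beta)
  qed
  also have "\<dots> = (\<Sum>i < ?n. \<Sum>e \<in> ?E. ?w e * of_bool (?reach i e))"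
    using fin by (intro sum.cong refl sum.mono_neutral_cong_left) auto
  \<comment> \<open>Exchanging the sums counts each edge once for every source below it, which is
    its load.\<close>
  also have "\<dots> = (\<Sum>e \<in> ?E. \<Sum>i < ?n. ?w e * of_bool (?reach i e))"
    by (rule sum.swap)
  also have "\<dots> = (\<Sum>e \<in> ?E. ?w e * real (load G (fst e)))"
    by (simp only: load sum_distrib_left)
  also have "\<dots> = layout_cost I (G, pos)"
    using assms by (simp add: layout_cost_def case_prod_beta)
  finally show ?thesis .
qed

text \<open>With height at most 1 every source hangs directly below its root. Its edge has load at
  least 1, so the factor \<open>load powr exponent\<close> is at least 1, and different sources have
  different edges.\<close>

lemma assignment_cost_target_le_direct:
  assumes "num_layers I = 0"
  shows "assignment_cost I target \<le> layout_cost I (G, pos)"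
proof -
  let ?n = "num_sources I" and ?E = "edges G"
  let ?c = "\<lambda>e. norm (pos (fst e) - pos (snd e)) * real (load G (fst e)) powr exponent I"
  let ?e = "\<lambda>i. (Source i, Sink (target i))"
  have edge: "?e i \<in> ?E" if i: "i < ?n" for i
  proof -
    obtain k where k: "?e i \<in> ?E ^^ k"
      using target(2)[OF i] rtrancl_imp_relpow by blast
    then have "layer G (Source i) = k"
      using layer_eqI[OF forest target(1)[OF i]] by simp
    moreover have "layer G (Source i) \<le> 1"
      using valid i source_in_verts assms
      by (auto simp: valid_layout_def valid_topology_def topology_for_def)
    moreover have "k \<noteq> 0"
      using k by (cases k) auto
    ultimately have "k = 1"
      by simp
    then show ?thesis
      using k by simp
  qed
  have "norm (pos (Source i) - pos (Sink (target i))) \<le> ?c (?e i)" if i: "i < ?n" for i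
  proof -
    have "finite {k. Source k \<in> verts G \<and> (Source k, Source i) \<in> ?E\<^sup>*}"
      by (rule finite_subset[of _ "{..<?n}"]) (auto simp: source_in_verts)
    moreover have "i \<in> {k. Source k \<in> verts G \<and> (Source k, Source i) \<in> ?E\<^sup>*}"
      using i source_in_verts by simp
    ultimately have "load G (Source i) > 0"
      unfolding load_def by (auto simp: card_gt_0_iff)
    then have "1 \<le> real (load G (Source i)) powr exponent I"
      using inst by (intro ge_one_powr_ge_zero) (auto simp: flamecast_instance_def)
    then show ?thesis
      using mult_left_mono[of 1 "real (load G (Source i)) powr exponent I"
          "norm (pos (Source i) - pos (Sink (target i)))"] by simp
  qed
  then have "assignment_cost I target \<le> (\<Sum>i < ?n. ?c (?e i))"
    unfolding assignment_cost_target by (intro sum_mono) simp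
  also have "\<dots> = (\<Sum>e \<in> ?e ` {..<?n}. ?c e)"
    by (subst sum.reindex) (auto simp: inj_on_def)
  also have "\<dots> \<le> (\<Sum>e \<in> ?E. ?c e)"
    using fin edge by (intro sum_mono2) auto
  also have "\<dots> = layout_cost I (G, pos)"
    by (simp add: layout_cost_def case_prod_beta)
  finally show ?thesis .
qed

end

lemma assignment_of_layout:
  assumes "flamecast_instance I" "exponent I = 1 \<or> num_layers I = 0" "valid_layout I L"
  shows "\<exists>f. assignment I f \<and> assignment_cost I f \<le> layout_cost I L"
proof -
  obtain G pos where L: "L = (G, pos)"
    by (cases L)
  interpret feasible_layout I G pos
    using assms L by unfold_locales auto
  have "assignment_cost I target \<le> layout_cost I L"
    unfolding L using assms(2) assignment_cost_target_le_linear assignment_cost_target_le_direct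
    by (elim disjE) simp_all
  then show ?thesis
    using assignment_target by auto
qed

section \<open>Feasibility and direct layouts\<close>

lemma assignment_num_sources_le:
  assumes "assignment I f"
  shows "num_sources I \<le> cap I 0 * num_sinks I"
proof -
  let ?F = "\<lambda>j. {i. i < num_sources I \<and> f i = j}"
  have "{..<num_sources I} \<subseteq> (\<Union>j < num_sinks I. ?F j)"
    using assms by (auto simp: assignment_def)
  then have "card {..<num_sources I} \<le> card (\<Union>j < num_sinks I. ?F j)"
    by (intro card_mono) auto
  also have "\<dots> \<le> (\<Sum>j < num_sinks I. card (?F j))"
    by (rule card_UN_le) simp
  also have "\<dots> \<le> (\<Sum>j < num_sinks I. cap I 0)"
    using assms by (intro sum_mono) (simp add: assignment_def)
  finally show ?thesis
    by (simp add: mult.commute)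
qed

text \<open>Without Steiner vertices the output is a star around each sink that is used; other sinks
  are not vertices. Sources are in layer 1 with load 1, so \<open>c1 \<ge> 1\<close> suffices there,
  and every exponent yields the factor 1.\<close>

lemma star_layout:
  assumes inst: "flamecast_instance I"
    and steiner: "nmem s ''num_steiner'' 0 = 0"
    and assg: "assignment I (nmem s ''parent'')"
  shows "valid_layout I (output_layout I s)"
    and "layout_cost I (output_layout I s) = assignment_cost I (nmem s ''parent'')"
proof -
  let ?n = "num_sources I" and ?f = "nmem s ''parent''"
  define E where "E = (\<lambda>i. (Source i, Sink (?f i))) ` {..<?n}"
  define G where "G = \<lparr>verts = Field E, edges = E\<rparr>"
  have f: "?f i < num_sinks I" if "i < ?n" for i
    using assg that by (simp add: assignment_def)
  have oE: "output_edges I s = E"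
    unfolding output_edges_def E_def using steiner f
    by (auto simp: output_parent_def Let_def)
  have L: "output_layout I s = (G, output_pos I s)"
    by (simp add: output_layout_def oE G_def)
  have E: "(x, y) \<in> E \<longleftrightarrow> (\<exists>i < ?n. x = Source i \<and> y = Sink (?f i))" for x y
    by (auto simp: E_def)
  \<comment> \<open>Tails are sources and heads are sinks, so no two edges can be composed.\<close>
  have tr: "(x, y) \<in> E\<^sup>* \<longleftrightarrow> x = y \<or> (x, y) \<in> E" for x y
  proof
    assume "(x, y) \<in> E\<^sup>*"
    then show "x = y \<or> (x, y) \<in> E"
      by (induction rule: rtrancl_induct) (auto simp: E)
  qed auto
  have "acyclic E"
    unfolding acyclic_def
  proof (intro allI notI)
    fix x assume "(x, x) \<in> E\<^sup>+"
    then show False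
      by (auto dest!: tranclD simp: tr E)
  qed
  moreover have "finite E"
    by (simp add: E_def)
  ultimately have forest: "rooted_forest G"
    by (auto simp: rooted_forest_def G_def single_valued_def E intro!: finite_Field
        intro: FieldI1 FieldI2)

  have verts: "verts G = Source ` {..<?n} \<union> Sink ` ?f ` {..<?n}"
    by (auto simp: G_def Field_def E Domain_iff Range_iff)
  have roots: "roots G = Sink ` ?f ` {..<?n}"
    by (auto simp: roots_def verts) (auto simp: G_def E Domain_iff)
  have leaves: "leaves G = Source ` {..<?n}"
    by (auto simp: leaves_def verts) (auto simp: G_def E Range_iff)
  have layer_source: "layer G (Source i) = 1" if "i < ?n" for i
    by (rule layer_eqI[OF forest, of "Sink (?f i)"]) (use that in \<open>simp_all add: roots\<close>, simp add: G_def E)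
  have layer_sink: "layer G (Sink (?f i)) = 0" if "i < ?n" for i
    by (rule layer_eqI[OF forest, of "Sink (?f i)"]) (use that in \<open>auto simp: roots\<close>)
  have load_source: "load G (Source i) = 1" if "i < ?n" for i
  proof -
    have "{k. Source k \<in> verts G \<and> (Source k, Source i) \<in> (edges G)\<^sup>*} = {i}"
      using that by (auto simp: verts) (auto simp: G_def tr E)
    then show ?thesis
      by (simp add: load_def)
  qed
  have load_sink: "load G (Sink j) = card {i. i < ?n \<and> ?f i = j}" for j
  proof -
    have "{k. Source k \<in> verts G \<and> (Source k, Sink j) \<in> (edges G)\<^sup>*} = {i. i < ?n \<and> ?f i = j}"
      by (auto simp: verts) (auto simp: G_def tr E)
    then show ?thesis
      by (simp add: load_def)
  qed
  have cap1: "cap I 1 \<ge> 1"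
    using inst by (auto simp: flamecast_instance_def cap_def)
  have "topology_for I G"
    unfolding topology_for_def using forest f layer_source layer_sink
    by (auto simp: verts roots leaves)
  then have "valid_topology I G"
    unfolding valid_topology_def using assg cap1
    by (auto simp: verts layer_source layer_sink load_source load_sink assignment_def)
  moreover have "embedding_for I G (output_pos I s)"
    by (simp add: embedding_for_def output_pos_def)
  ultimately show "valid_layout I (output_layout I s)"
    by (simp add: L valid_layout_def)
  have "layout_cost I (output_layout I s) =
      (\<Sum>i < ?n. norm (output_pos I s (Source i) - output_pos I s (Sink (?f i)))
         * real (load G (Source i)) powr exponent I)"
    by (simp add: L layout_cost_def G_def) (simp add: E_def sum.reindex inj_on_def)
  also have "\<dots> = assignment_cost I ?f"
    by (simp add: assignment_cost_def load_source output_pos_def)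
  finally show "layout_cost I (output_layout I s) = assignment_cost I ?f" .
qed

text \<open>Feasibility is equivalent to the counting bound: one direction is the pigeonhole
  principle, the other comes from the assignment that the program itself delivers. Every valid
  layout costs at least as much as some assignment, and the star of a cheapest assignment attains
  the minimum.\<close>

lemma correct_outputI:
  assumes inst: "flamecast_instance I" "exponent I = 1 \<or> num_layers I = 0"
    and infeasible: "num_sources I > cap I 0 * num_sinks I \<Longrightarrow> nmem s ''feasible'' 0 = 0"
    and feasible: "num_sources I \<le> cap I 0 * num_sinks I \<Longrightarrow>
      nmem s ''feasible'' 0 = 1 \<and> nmem s ''num_steiner'' 0 = 0 \<and>
      assignment I (nmem s ''parent'') \<and>
      (\<forall>f. assignment I f \<longrightarrow> assignment_cost I (nmem s ''parent'') \<le> assignment_cost I f)"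
  shows "correct_output I s"
proof (cases "num_sources I \<le> cap I 0 * num_sinks I")
  case True
  note * = feasible[OF True]
  have "min_cost_layout I (output_layout I s)"
    unfolding min_cost_layout_def
  proof (intro conjI allI impI)
    show "valid_layout I (output_layout I s)"
      using star_layout(1)[OF inst(1)] * by blast
  next
    fix L assume "valid_layout I L"
    then obtain f where "assignment I f" "assignment_cost I f \<le> layout_cost I L"
      using assignment_of_layout[OF inst] by blast
    moreover have "layout_cost I (output_layout I s) = assignment_cost I (nmem s ''parent'')"
      using star_layout(2)[OF inst(1)] * by blast
    ultimately show "layout_cost I (output_layout I s) \<le> layout_cost I L"
      using * by fastforce
  qed
  then show ?thesis
    using * unfolding correct_output_def min_cost_layout_def by metis
next
  case False
  then have "\<not> (\<exists>L. valid_layout I L)"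
    using assignment_of_layout[OF inst] assignment_num_sources_le by blast
  then show ?thesis
    using infeasible False by (simp add: correct_output_def)
qed

section \<open>The Hungarian method\<close>

locale assignment_problem =
  fixes n N :: nat and a :: "nat \<Rightarrow> nat \<Rightarrow> real"
  assumes rows_le: "n \<le> N" and a_nonneg: "a x j \<ge> 0"
begin

text \<open>
  Rows and columns are numbered from 1, and \<open>p j = 0\<close> means that column \<open>j\<close> is unmatched. Column \<open>h\<close>
  is a hole: its entry in \<open>p\<close> is stale. Column 0 is a virtual partner of the row being inserted,
  and the hole \<open>N + 1\<close> means that there is no hole.
\<close>

definition dual_matching ::
    "nat \<Rightarrow> nat \<Rightarrow> (nat \<Rightarrow> nat) \<Rightarrow> (nat \<Rightarrow> real) \<Rightarrow> (nat \<Rightarrow> real) \<Rightarrow> bool" where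
  "dual_matching h r p u v \<longleftrightarrow>
     (\<forall>x \<in> {1..n}. \<forall>j \<in> {1..N}. u x + v j \<le> a x j) \<and>
     (\<forall>j \<in> {1..N}. v j \<le> 0) \<and>
     (\<forall>j \<in> {1..N} - {h}. if p j = 0 then v j = 0 else u (p j) + v j = a (p j) j) \<and>
     bij_betw p {j \<in> {..N} - {h}. p j \<noteq> 0} {1..r}"

text \<open>Zero potentials are dual feasible because costs are nonnegative. Between insertions the
  hole is column 0, whose entry may be left over from the last row.\<close>

lemma dual_matching_init: "dual_matching 0 0 (\<lambda>_. 0) (\<lambda>_. 0) (\<lambda>_. 0)"
  by (simp add: dual_matching_def a_nonneg bij_betw_def)

text \<open>The entry at the hole and the potential of column 0 are free to change, which lets a new
  row be written into column 0.\<close>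

lemma dual_matching_cong:
  assumes "dual_matching h r p u v"
    and "\<And>j. j \<le> N \<Longrightarrow> j \<noteq> h \<Longrightarrow> p' j = p j" "\<And>x. u' x = u x" "\<And>j. 1 \<le> j \<Longrightarrow> j \<le> N \<Longrightarrow> v' j = v j"
  shows "dual_matching h r p' u' v'"
proof -
  have "{j \<in> {..N} - {h}. p' j \<noteq> 0} = {j \<in> {..N} - {h}. p j \<noteq> 0}"
    using assms(2) by auto
  then have "bij_betw p' {j \<in> {..N} - {h}. p' j \<noteq> 0} {1..r}
      \<longleftrightarrow> bij_betw p {j \<in> {..N} - {h}. p j \<noteq> 0} {1..r}"
    using assms(2) by (simp only:) (rule bij_betw_cong, auto)
  then show ?thesis
    using assms by (simp add: dual_matching_def)
qed

text \<open>Filling the hole at column 0 gives the new row a partner at once. No tight edge is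
  required there, because the dual constraints speak only of columns \<open>1\<close> to
  \<open>N\<close>.\<close>

lemma dual_matching_add_row:
  assumes "dual_matching 0 r p u v" "p 0 = Suc r"
  shows "dual_matching (Suc N) (Suc r) p u v"
proof -
  have "bij_betw p {j \<in> {..N} - {0}. p j \<noteq> 0} {1..r}"
    using assms(1) by (simp add: dual_matching_def)
  then have "bij_betw p (insert 0 {j \<in> {..N} - {0}. p j \<noteq> 0}) (insert (p 0) {1..r})"
    using assms(2) notIn_Un_bij_betw[of 0 "{j \<in> {..N} - {0}. p j \<noteq> 0}" p "{1..r}"] by simp
  moreover have "insert 0 {j \<in> {..N} - {0}. p j \<noteq> 0} = {j \<in> {..N} - {Suc N}. p j \<noteq> 0}"
    using assms(2) by auto
  moreover have "insert (p 0) {1..r} = {1..Suc r}"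
    using assms(2) by auto
  ultimately show ?thesis
    using assms(1) by (simp add: dual_matching_def)
qed

lemma dual_matching_hole:
  assumes "dual_matching (Suc N) r p u v" "p c = 0"
  shows "dual_matching c r p u v"
proof -
  have "{j \<in> {..N} - {c}. p j \<noteq> 0} = {j \<in> {..N} - {Suc N}. p j \<noteq> 0}"
    using assms(2) by auto
  then show ?thesis
    using assms by (simp add: dual_matching_def)
qed

text \<open>One elementary step of the augmentation: the row of \<open>h'\<close> is copied along a
  tight edge into the hole, its old entry becomes stale, and \<open>h'\<close> is the new hole. All
  \<open>r\<close> rows stay matched after every such step, so the path never has to be flipped as a
  whole.\<close>

lemma dual_matching_move_hole:
  assumes M: "dual_matching h r p u v"
    and h: "1 \<le> h" "h \<le> N" and h': "h' \<le> N" "h' \<noteq> h" "p h' \<noteq> 0"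
    and tight: "u (p h') + v h = a (p h') h"
  shows "dual_matching h' r (p(h := p h')) u v"
proof -
  let ?p = "p(h := p h')"
  let ?A = "{j \<in> {..N} - {h}. p j \<noteq> 0}"
  have bij: "bij_betw p ?A {1..r}"
    using M by (simp add: dual_matching_def)
  have eq: "{j \<in> {..N} - {h'}. ?p j \<noteq> 0} = insert h (?A - {h'})"
    using h h' by auto
  have inA: "h' \<in> ?A"
    using h' by auto
  have "bij_betw p (?A - {h'}) ({1..r} - {p h'})"
    using bij inA by (auto simp: bij_betw_def inj_on_image_set_diff[of p ?A] inj_on_diff)
  then have "bij_betw ?p (?A - {h'}) ({1..r} - {p h'})"
    by (subst bij_betw_cong[of _ _ p]) auto
  then have "bij_betw ?p (insert h (?A - {h'})) (insert (?p h) ({1..r} - {p h'}))"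
    using notIn_Un_bij_betw[of h "?A - {h'}" ?p "{1..r} - {p h'}"] by simp
  moreover have "insert (?p h) ({1..r} - {p h'}) = {1..r}"
    using bij inA by (auto simp: bij_betw_def)
  ultimately show ?thesis
    using M tight h h' unfolding dual_matching_def eq by auto
qed

text \<open>
  \<open>U\<close> is the set of scanned columns, \<open>w\<close> the predecessor map of the search tree, and \<open>\<rho>\<close> a ghost
  rank, decreasing along \<open>w\<close>, that bounds the length of the augmenting path.
\<close>

definition search_tree ::
    "nat set \<Rightarrow> (nat \<Rightarrow> nat) \<Rightarrow> (nat \<Rightarrow> real) \<Rightarrow> (nat \<Rightarrow> real) \<Rightarrow> (nat \<Rightarrow> nat) \<Rightarrow> (nat \<Rightarrow> nat) \<Rightarrow> bool" where
  "search_tree U p u v w \<rho> \<longleftrightarrow>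
     U \<subseteq> {..N} \<and>
     (\<forall>j \<in> U. \<rho> j < card U \<and> p j \<noteq> 0 \<and>
        (j \<noteq> 0 \<longrightarrow> w j \<in> U \<and> \<rho> (w j) < \<rho> j \<and> u (p (w j)) + v j = a (p (w j)) j))"

text \<open>The tentative distances of Dijkstra's algorithm, measured relative to the current
  potentials.\<close>

definition frontier ::
    "nat set \<Rightarrow> (nat \<Rightarrow> nat) \<Rightarrow> (nat \<Rightarrow> real) \<Rightarrow> (nat \<Rightarrow> real) \<Rightarrow> (nat \<Rightarrow> nat) \<Rightarrow> (nat \<Rightarrow> real) \<Rightarrow> bool" where
  "frontier U p u v w m \<longleftrightarrow>
     (\<forall>j \<in> {1..N} - U. w j \<in> U \<and> m j = a (p (w j)) j - u (p (w j)) - v j \<and>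
        (\<forall>y \<in> U. m j \<le> a (p y) j - u (p y) - v j))"

text \<open>\<open>c\<close> is the column reached but not yet scanned. Before the first scan
  \<open>w\<close> and \<open>m\<close> may hold values from the preceding insertion, so nothing is
  demanded of them; afterwards \<open>m c = 0\<close> records that \<open>c\<close> is reached by a
  tight edge.\<close>

definition search ::
    "nat \<Rightarrow> nat set \<Rightarrow> nat \<Rightarrow> (nat \<Rightarrow> nat) \<Rightarrow> (nat \<Rightarrow> real) \<Rightarrow> (nat \<Rightarrow> real) \<Rightarrow> (nat \<Rightarrow> nat)
      \<Rightarrow> (nat \<Rightarrow> real) \<Rightarrow> bool" where
  "search r U c p u v w m \<longleftrightarrow>
     dual_matching (Suc N) r p u v \<and> p 0 \<noteq> 0 \<and> c \<le> N \<and> c \<notin> U \<and>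
     (\<exists>\<rho>. search_tree U p u v w \<rho>) \<and>
     (if U = {} then c = 0 else 0 \<in> U \<and> m c = 0 \<and> frontier U p u v w m)"

text \<open>The test \<open>c = 0\<close> stands for an infinite initial slack: the scan from column
  0 comes first and overwrites whatever the unscanned columns contain.\<close>

definition relaxed ::
    "nat \<Rightarrow> nat set \<Rightarrow> (nat \<Rightarrow> nat) \<Rightarrow> (nat \<Rightarrow> real) \<Rightarrow> (nat \<Rightarrow> real) \<Rightarrow> (nat \<Rightarrow> nat)
      \<Rightarrow> (nat \<Rightarrow> real) \<Rightarrow> (nat \<Rightarrow> nat) \<Rightarrow> (nat \<Rightarrow> real) \<Rightarrow> nat \<Rightarrow> bool" where
  "relaxed c U p u v w m w' m' j \<longleftrightarrow>
     (let x = a (p c) j - u (p c) - v j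
      in if j \<notin> U \<and> (c = 0 \<or> x < m j) then w' j = c \<and> m' j = x else w' j = w j \<and> m' j = m j)"

text \<open>The \<open>N + 1\<close> columns, the virtual one included, cannot all be matched to at
  most \<open>N\<close> rows. Hence every scan finds a column to continue with.\<close>

lemma unused_column:
  assumes M: "dual_matching (Suc N) r p u v" and "r \<le> n"
    and U: "0 \<in> U" "U \<subseteq> {..N}" "\<forall>j \<in> U. p j \<noteq> 0"
  shows "{1..N} - U \<noteq> {}"
proof
  assume "{1..N} - U = {}"
  moreover have "j = 0 \<or> j \<in> {1..N}" if "j \<le> N" for j
    using that by auto
  ultimately have "U = {..N}"
    using U(1,2) by blast
  then have "{..N} \<subseteq> {j \<in> {..N} - {Suc N}. p j \<noteq> 0}"
    using U(3) by auto
  moreover have bij: "bij_betw p {j \<in> {..N} - {Suc N}. p j \<noteq> 0} {1..r}"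
    using M by (simp add: dual_matching_def)
  ultimately have "card {..N} \<le> card {1..r}"
    by (metis (no_types, lifting) bij_betw_same_card card_mono bij_betw_finite finite_atLeastAtMost)
  then show False
    using rows_le assms(2) by simp
qed

text \<open>What a scan relies on: a genuine row, a remaining candidate column, and injectivity of
  \<open>p\<close>, without which raising potentials column by column could raise a row
  twice.\<close>

lemma search_next:
  assumes S: "search r U c p u v w m" and r: "r \<le> n" and pc: "p c \<noteq> 0"
  shows "p c \<in> {1..r}" "inj_on p (insert c U)" "{1..N} - insert c U \<noteq> {}"
    "finite U" "c \<notin> U" "insert c U \<subseteq> {..N}"
proof -
  have M: "dual_matching (Suc N) r p u v" and sub: "insert c U \<subseteq> {..N}"
    and p: "\<forall>j \<in> insert c U. p j \<noteq> 0" and zero: "0 \<in> insert c U"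
    and c: "c \<notin> U"
    using S pc by (auto simp: search_def search_tree_def split: if_splits)
  show "{1..N} - insert c U \<noteq> {}"
    by (rule unused_column[OF M r zero sub p])
  show "c \<notin> U"
    by (rule c)
  show "finite U" "insert c U \<subseteq> {..N}"
    using sub by (auto intro: finite_subset)
  have bij: "bij_betw p {j \<in> {..N} - {Suc N}. p j \<noteq> 0} {1..r}"
    using M by (simp add: dual_matching_def)
  have sub': "insert c U \<subseteq> {j \<in> {..N} - {Suc N}. p j \<noteq> 0}"
    using sub p by auto
  show "p c \<in> {1..r}"
    using sub' by (intro bij_betw_apply[OF bij]) simp
  show "inj_on p (insert c U)"
    by (rule inj_on_subset[OF bij_betw_imp_inj_on[OF bij] sub'])
qed

lemma search_init:
  assumes "dual_matching (Suc N) r p u v" "p 0 \<noteq> 0"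
  shows "search r {} 0 p u v w m"
  using assms by (simp add: search_def search_tree_def)

text \<open>The part of a scan that leaves the potentials alone: \<open>c\<close> joins the tree,
  its edge being tight by \<open>m c = 0\<close>, and the frontier is compared with the row of
  \<open>c\<close>.\<close>

lemma search_relax:
  assumes S: "search r U c p u v w m" and pc: "p c \<noteq> 0"
    and relax: "\<And>j. j \<in> {1..N} \<Longrightarrow> relaxed c (insert c U) p u v w m w' m' j"
  shows "\<exists>\<rho>. search_tree (insert c U) p u v w' \<rho>"
    and "frontier (insert c U) p u v w' m'"
proof -
  let ?U = "insert c U"
  obtain \<rho> where tree: "search_tree U p u v w \<rho>"
    using S by (auto simp: search_def)
  have S': "U \<noteq> {} \<Longrightarrow> frontier U p u v w m" "c \<le> N" "c \<notin> U" "U = {} \<Longrightarrow> c = 0"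
      "U \<noteq> {} \<Longrightarrow> 0 \<in> U \<and> m c = 0"
    using S by (auto simp: search_def split: if_splits)
  have c0: "c = 0 \<longleftrightarrow> U = {}"
    using S' by auto
  have fin: "finite U"
    using tree by (auto simp: search_tree_def intro: finite_subset)
  have card: "card ?U = Suc (card U)"
    using fin S'(3) by simp
  \<comment> \<open>Relaxation skips scanned columns, so predecessors inside the tree are
    final.\<close>
  have old: "w' j = w j" if "j \<in> ?U" "j \<noteq> 0" for j
    using relax[of j] that tree S'(2) by (auto simp: relaxed_def search_tree_def Let_def)
  have ctight: "w c \<in> U \<and> u (p (w c)) + v c = a (p (w c)) c" if "c \<noteq> 0"
  proof -
    have "c \<in> {1..N} - U" "m c = 0" "U \<noteq> {}"
      using that S' c0 by auto
    then show ?thesis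
      using S'(1) unfolding frontier_def by force
  qed
  \<comment> \<open>All earlier ranks are below \<open>card U\<close>, so \<open>c\<close> can take
    this value as its own.\<close>
  have "search_tree ?U p u v w' (\<rho>(c := card U))"
    unfolding search_tree_def
  proof (intro conjI ballI)
    show "?U \<subseteq> {..N}"
      using tree S'(2) by (auto simp: search_tree_def)
  next
    fix j assume j: "j \<in> ?U"
    show "(\<rho>(c := card U)) j < card ?U"
      using j tree card by (auto simp: search_tree_def less_Suc_eq)
    show "p j \<noteq> 0"
      using j tree pc by (auto simp: search_tree_def)
    show "j \<noteq> 0 \<longrightarrow> w' j \<in> ?U \<and> (\<rho>(c := card U)) (w' j) < (\<rho>(c := card U)) j
        \<and> u (p (w' j)) + v j = a (p (w' j)) j"
    proof
      assume j0: "j \<noteq> 0"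
      show "w' j \<in> ?U \<and> (\<rho>(c := card U)) (w' j) < (\<rho>(c := card U)) j
        \<and> u (p (w' j)) + v j = a (p (w' j)) j"
      proof (cases "j = c")
        case True
        then have "w c \<in> U" "w c \<noteq> c"
          using ctight j0 S'(3) by auto
        then show ?thesis
          using True ctight j0 old[OF j j0] tree by (auto simp: search_tree_def)
      next
        case False
        then have "j \<in> U"
          using j by auto
        then have "w j \<in> U \<and> \<rho> (w j) < \<rho> j \<and> u (p (w j)) + v j = a (p (w j)) j"
          using tree j0 unfolding search_tree_def by blast
        moreover from this have "w j \<noteq> c"
          using S'(3) by auto
        ultimately show ?thesis
          using False old[OF j j0] by auto
      qed
    qed
  qed
  then show "\<exists>\<rho>. search_tree ?U p u v w' \<rho>"
    by blast
  show "frontier ?U p u v w' m'"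
    unfolding frontier_def
  proof
    fix j assume j: "j \<in> {1..N} - ?U"
    let ?x = "a (p c) j - u (p c) - v j"
    have rj: "relaxed c ?U p u v w m w' m' j"
      using relax j by simp
    have fj: "w j \<in> U \<and> m j = a (p (w j)) j - u (p (w j)) - v j \<and>
        (\<forall>y \<in> U. m j \<le> a (p y) j - u (p y) - v j)" if "U \<noteq> {}"
      using S'(1)[OF that] j unfolding frontier_def by blast
    show "w' j \<in> ?U \<and> m' j = a (p (w' j)) j - u (p (w' j)) - v j \<and>
        (\<forall>y \<in> ?U. m' j \<le> a (p y) j - u (p y) - v j)"
    proof (cases "c = 0 \<or> ?x < m j")
      case True
      then have "w' j = c" "m' j = ?x"
        using rj j by (auto simp: relaxed_def Let_def)
      then show ?thesis
        using fj True c0 by (cases "U = {}") force+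
    next
      case False
      then have "w' j = w j" "m' j = m j"
        using rj j by (auto simp: relaxed_def Let_def)
      then show ?thesis
        using fj False c0 by auto
    qed
  qed
qed

text \<open>The dual adjustment by the least slack. Raising scanned rows and lowering scanned
  columns equally keeps tree edges tight; edges from scanned rows to unscanned columns lose that
  amount, which their slack covers; in the opposite direction slack only grows. The minimiser
  \<open>d\<close> ends with slack 0 and is reached next.\<close>

lemma search_step:
  assumes S: "search r U c p u v w m" and r: "r \<le> n" and pc: "p c \<noteq> 0"
    and relax: "\<And>j. j \<in> {1..N} \<Longrightarrow> relaxed c (insert c U) p u v w m w' m' j"
    and d: "d \<in> {1..N} - insert c U" "\<And>j. j \<in> {1..N} - insert c U \<Longrightarrow> m' d \<le> m' j"
    and u': "\<And>x. u' x = u x + (if x \<in> p ` insert c U then m' d else 0)"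
    and v': "\<And>j. j \<le> N \<Longrightarrow> v' j = v j - (if j \<in> insert c U then m' d else 0)"
    and m'': "\<And>j. j \<le> N \<Longrightarrow> m'' j = m' j - (if j \<in> insert c U then 0 else m' d)"
  shows "search r (insert c U) d p u' v' w' m''"
proof -
  let ?U = "insert c U" and ?\<delta> = "m' d"
  obtain \<rho> where tree: "search_tree ?U p u v w' \<rho>"
    using search_relax(1)[OF S pc relax] by blast
  have front: "frontier ?U p u v w' m'"
    using search_relax(2)[OF S pc relax] by blast
  have M: "dual_matching (Suc N) r p u v"
    using S by (simp add: search_def)
  have U: "?U \<subseteq> {..N}" "\<And>j. j \<in> ?U \<Longrightarrow> p j \<noteq> 0"
    using tree by (auto simp: search_tree_def)
  have bij: "bij_betw p {j \<in> {..N} - {Suc N}. p j \<noteq> 0} {1..r}"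
    using M by (simp add: dual_matching_def)
  then have inj: "inj_on p {j \<in> {..N} - {Suc N}. p j \<noteq> 0}"
    by (simp add: bij_betw_def)
  \<comment> \<open>By injectivity of \<open>p\<close> a matched row is raised exactly if its column
    is lowered, which keeps matched edges tight.\<close>
  have row_in: "p j \<in> p ` ?U \<longleftrightarrow> j \<in> ?U" if "j \<le> N" "p j \<noteq> 0" for j
    using inj_on_image_mem_iff[OF inj, of j ?U] that U by auto
  have feas: "u x + v j \<le> a x j" if "x \<in> {1..n}" "j \<in> {1..N}" for x j
    using M that by (simp add: dual_matching_def)
  have front': "m' j \<le> a (p y) j - u (p y) - v j" if "j \<in> {1..N} - ?U" "y \<in> ?U" for j y
    using front that unfolding frontier_def by blast
  have frontw: "w' j \<in> ?U" "m' j = a (p (w' j)) j - u (p (w' j)) - v j" if "j \<in> {1..N} - ?U" for j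
    using front that unfolding frontier_def by blast+
  have rows: "p j \<in> {1..r}" if "j \<in> ?U" for j
    using bij_betw_apply[OF bij, of j] U(1) U(2)[OF that] that by auto
  \<comment> \<open>The least slack is the reduced cost of a genuine row, hence nonnegative by dual
    feasibility.\<close>
  have \<delta>: "?\<delta> \<ge> 0"
    using frontw[OF d(1)] feas[of "p (w' d)" d] rows[of "w' d"] d(1) r by auto
  have "dual_matching (Suc N) r p u' v'"
    unfolding dual_matching_def
  proof (intro conjI ballI)
    fix x j assume x: "x \<in> {1..n}" and j: "j \<in> {1..N}"
    show "u' x + v' j \<le> a x j"
    proof (cases "x \<in> p ` ?U \<and> j \<notin> ?U")
      case True
      then obtain y where "x = p y" "y \<in> ?U"
        by blast
      then have "m' j \<le> a x j - u x - v j" "?\<delta> \<le> m' j"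
        using front'[of j y] d(2)[of j] j True by auto
      then show ?thesis
        using True j by (simp add: u' v')
    next
      case False
      then show ?thesis
        using feas[OF x j] \<delta> j by (auto simp: u' v')
    qed
  next
    fix j assume j: "j \<in> {1..N}"
    then have "v j \<le> 0"
      using M by (simp add: dual_matching_def)
    then show "v' j \<le> 0"
      using \<delta> j by (simp add: v')
  next
    fix j assume j: "j \<in> {1..N} - {Suc N}"
    then have "if p j = 0 then v j = 0 else u (p j) + v j = a (p j) j"
      using M unfolding dual_matching_def by blast
    \<comment> \<open>An unmatched column is not among the scanned ones, so it keeps potential
      0.\<close>
    then show "if p j = 0 then v' j = 0 else u' (p j) + v' j = a (p j) j"
      using j U(2)[of j] row_in[of j] by (cases "p j = 0"; cases "j \<in> ?U") (simp_all add: u' v')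
  qed (rule bij)
  moreover have "search_tree ?U p u' v' w' \<rho>"
    unfolding search_tree_def
  proof (intro conjI ballI U(1))
    fix j assume j: "j \<in> ?U"
    have tj: "\<rho> j < card ?U \<and> p j \<noteq> 0 \<and>
        (j \<noteq> 0 \<longrightarrow> w' j \<in> ?U \<and> \<rho> (w' j) < \<rho> j \<and> u (p (w' j)) + v j = a (p (w' j)) j)"
      using tree j unfolding search_tree_def by blast
    then show "\<rho> j < card ?U" "p j \<noteq> 0"
      by blast+
    show "j \<noteq> 0 \<longrightarrow> w' j \<in> ?U \<and> \<rho> (w' j) < \<rho> j \<and> u' (p (w' j)) + v' j = a (p (w' j)) j"
    proof
      assume "j \<noteq> 0"
      then have *: "w' j \<in> ?U" "\<rho> (w' j) < \<rho> j" "u (p (w' j)) + v j = a (p (w' j)) j"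
        using tj by blast+
      moreover have "u' (p (w' j)) = u (p (w' j)) + ?\<delta>"
        using *(1) by (simp only: u') (simp only: imageI if_True)
      moreover have "v' j = v j - ?\<delta>"
        using v'[of j] j U(1) by auto
      ultimately show "w' j \<in> ?U \<and> \<rho> (w' j) < \<rho> j \<and> u' (p (w' j)) + v' j = a (p (w' j)) j"
        by linarith
    qed
  qed
  moreover have "frontier ?U p u' v' w' m''"
    unfolding frontier_def
  proof
    fix j assume j: "j \<in> {1..N} - ?U"
    have ux: "u' (p y) = u (p y) + ?\<delta>" if "y \<in> ?U" for y
      using that by (simp only: u') (simp only: imageI if_True)
    have vj: "v' j = v j" and mj: "m'' j = m' j - ?\<delta>"
      using j by (simp_all add: v' m'')
    show "w' j \<in> ?U \<and> m'' j = a (p (w' j)) j - u' (p (w' j)) - v' j \<and>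
        (\<forall>y \<in> ?U. m'' j \<le> a (p y) j - u' (p y) - v' j)"
    proof (intro conjI ballI)
      show "w' j \<in> ?U"
        by (rule frontw(1)[OF j])
      show "m'' j = a (p (w' j)) j - u' (p (w' j)) - v' j"
        using frontw(2)[OF j] ux[OF frontw(1)[OF j]] vj mj by linarith
    next
      fix y assume y: "y \<in> ?U"
      show "m'' j \<le> a (p y) j - u' (p y) - v' j"
        using front'[OF j y] ux[OF y] vj mj by linarith
    qed
  qed
  moreover have "0 \<in> ?U" "m'' d = 0"
    using S d(1) by (auto simp: search_def m'' split: if_splits)
  ultimately show ?thesis
    using S d(1) by (auto simp: search_def)
qed

text \<open>The tree conditions are kept only for columns of rank at most that of the hole. Columns
  already passed have larger rank and new entries in \<open>p\<close>, so nothing is claimed about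
  their tree edges any more.\<close>

definition augmenting ::
    "nat \<Rightarrow> nat \<Rightarrow> nat set \<Rightarrow> (nat \<Rightarrow> nat) \<Rightarrow> (nat \<Rightarrow> real) \<Rightarrow> (nat \<Rightarrow> real) \<Rightarrow> (nat \<Rightarrow> nat)
      \<Rightarrow> (nat \<Rightarrow> nat) \<Rightarrow> bool" where
  "augmenting r h V p u v w \<rho> \<longleftrightarrow>
     dual_matching h r p u v \<and> h \<in> V \<and> V \<subseteq> {..N} \<and>
     (\<forall>j \<in> V. j \<noteq> 0 \<and> \<rho> j \<le> \<rho> h \<longrightarrow>
        w j \<in> V \<and> \<rho> (w j) < \<rho> j \<and> p (w j) \<noteq> 0 \<and> u (p (w j)) + v j = a (p (w j)) j)"

text \<open>The end of the path is unmatched and may be declared the hole. Its rank becomes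
  \<open>card U\<close>, which is at most \<open>N + 1\<close> and bounds the number of steps back
  to column 0.\<close>

lemma augmenting_init:
  assumes S: "search r U c p u v w m" and pc: "p c = 0"
  shows "\<exists>\<rho>. augmenting r c (insert c U) p u v w \<rho> \<and> \<rho> c \<le> Suc N"
proof -
  obtain \<rho> where tree: "search_tree U p u v w \<rho>"
    using S by (auto simp: search_def)
  have S': "frontier U p u v w m" "c \<le> N" "c \<notin> U" "0 \<in> U" "m c = 0"
      "dual_matching (Suc N) r p u v"
    using S pc by (auto simp: search_def split: if_splits)
  let ?\<rho> = "\<rho>(c := card U)"
  have "c \<in> {1..N} - U"
    using S' by (cases "c = 0") auto
  then have cc: "w c \<in> U" "m c = a (p (w c)) c - u (p (w c)) - v c"
    using S'(1) unfolding frontier_def by blast+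
  have inU: "\<rho> j < card U \<and> p j \<noteq> 0 \<and>
        (j \<noteq> 0 \<longrightarrow> w j \<in> U \<and> \<rho> (w j) < \<rho> j \<and> u (p (w j)) + v j = a (p (w j)) j)" if "j \<in> U" for j
    using tree that unfolding search_tree_def by blast
  have "w j \<in> insert c U \<and> ?\<rho> (w j) < ?\<rho> j \<and> p (w j) \<noteq> 0 \<and> u (p (w j)) + v j = a (p (w j)) j"
    if j: "j \<in> insert c U" "j \<noteq> 0" for j
  proof (cases "j = c")
    case True
    moreover have "w c \<noteq> c"
      using cc S'(3) by auto
    ultimately show ?thesis
      using cc inU[of "w c"] S'(5) by auto
  next
    case False
    then have "j \<in> U" "w j \<in> U"
      using j inU by auto
    moreover from this have "w j \<noteq> c"
      using S'(3) by auto
    ultimately show ?thesis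
      using False inU[of j] inU[of "w j"] j by auto
  qed
  moreover have sub: "U \<subseteq> {..N}"
    using tree by (simp add: search_tree_def)
  moreover have "?\<rho> c \<le> Suc N"
    using card_mono[OF _ sub] by simp
  ultimately show ?thesis
    using S' dual_matching_hole[OF S'(6) pc] by (intro exI[of _ ?\<rho>]) (auto simp: augmenting_def)
qed

text \<open>Ranks decrease along \<open>w\<close>, so no column still ahead has the overwritten
  column \<open>h\<close> as its predecessor.\<close>

lemma augmenting_step:
  assumes A: "augmenting r h V p u v w \<rho>" and h: "h \<noteq> 0"
  shows "augmenting r (w h) V (p(h := p (w h))) u v w \<rho>" "\<rho> (w h) < \<rho> h"
proof -
  have *: "w j \<in> V \<and> \<rho> (w j) < \<rho> j \<and> p (w j) \<noteq> 0 \<and> u (p (w j)) + v j = a (p (w j)) j"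
    if "j \<in> V" "j \<noteq> 0" "\<rho> j \<le> \<rho> h" for j
    using A that unfolding augmenting_def by blast
  have V: "h \<in> V" "V \<subseteq> {..N}" "dual_matching h r p u v"
    using A by (auto simp: augmenting_def)
  note wh = *[OF V(1) h order_refl]
  then show "\<rho> (w h) < \<rho> h"
    by blast
  have "dual_matching (w h) r (p(h := p (w h))) u v"
    using V wh h by (intro dual_matching_move_hole) auto
  moreover have "w j \<in> V \<and> \<rho> (w j) < \<rho> j \<and> (p(h := p (w h))) (w j) \<noteq> 0
      \<and> u ((p(h := p (w h))) (w j)) + v j = a ((p(h := p (w h))) (w j)) j"
    if j: "j \<in> V" "j \<noteq> 0" "\<rho> j \<le> \<rho> (w h)" for j
  proof -
    note wj = *[OF j(1,2)]
    have "\<rho> j \<le> \<rho> h"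
      using j(3) wh by linarith
    then have "w j \<noteq> h"
      using wj j(3) wh by auto
    then show ?thesis
      using wj \<open>\<rho> j \<le> \<rho> h\<close> by auto
  qed
  ultimately show "augmenting r (w h) V (p(h := p (w h))) u v w \<rho>"
    using wh V unfolding augmenting_def by blast
qed

text \<open>Weak duality with complementary slackness. The matching costs the sum of all
  \<open>u\<close> and all \<open>v\<close>, as columns without a row have \<open>v = 0\<close>.
  Dropping terms \<open>v j \<le> 0\<close> can only increase this sum, so any other injection pays
  at least as much.\<close>

lemma dual_matching_optimal:
  assumes M: "dual_matching 0 n p u v"
    and q: "\<And>x. x \<in> {1..n} \<Longrightarrow> q x \<in> {1..N} \<and> p (q x) = x"
    and \<sigma>: "inj_on \<sigma> {1..n}" "\<sigma> ` {1..n} \<subseteq> {1..N}"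
  shows "(\<Sum>x \<in> {1..n}. a x (q x)) \<le> (\<Sum>x \<in> {1..n}. a x (\<sigma> x))"
proof -
  have v: "v j \<le> 0" "p j = 0 \<Longrightarrow> v j = 0" if "j \<in> {1..N}" for j
    using M that by (auto simp: dual_matching_def split: if_splits)
  have tight: "a x (q x) = u x + v (q x)" if "x \<in> {1..n}" for x
  proof -
    have "q x \<in> {1..N} - {0}"
      using q[OF that] by auto
    then have "if p (q x) = 0 then v (q x) = 0 else u (p (q x)) + v (q x) = a (p (q x)) (q x)"
      using M unfolding dual_matching_def by blast
    then show ?thesis
      using q[OF that] that by auto
  qed
  have qinj: "inj_on q {1..n}"
    using q by (metis inj_onI)
  \<comment> \<open>A column with nonzero potential carries a row, and injectivity of
    \<open>p\<close> identifies it with the column that \<open>q\<close> gives to this row.\<close>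
  have cover: "v j = 0" if "j \<in> {1..N} - q ` {1..n}" for j
  proof (rule ccontr)
    assume "v j \<noteq> 0"
    then have pj: "p j \<noteq> 0"
      using v(2) that by auto
    have bij: "bij_betw p {j \<in> {..N} - {0}. p j \<noteq> 0} {1..n}"
      using M by (simp add: dual_matching_def)
    then have "p j \<in> {1..n}"
      using pj that by (auto simp: bij_betw_def)
    then have "q (p j) = j"
      using bij_betw_imp_inj_on[OF bij] q[of "p j"] that pj by (auto dest!: inj_onD)
    then show False
      using that \<open>p j \<in> {1..n}\<close> by force
  qed
  have "(\<Sum>x \<in> {1..n}. a x (q x)) = (\<Sum>x \<in> {1..n}. u x) + (\<Sum>j \<in> q ` {1..n}. v j)"
    using qinj by (simp add: tight sum.distrib sum.reindex)
  also have "(\<Sum>j \<in> q ` {1..n}. v j) = (\<Sum>j \<in> {1..N}. v j)"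
    using q cover by (intro sum.mono_neutral_left) auto
  also have "(\<Sum>j \<in> {1..N}. v j) \<le> (\<Sum>j \<in> \<sigma> ` {1..n}. v j)"
  proof -
    have "(\<Sum>j \<in> \<sigma> ` {1..n}. - v j) \<le> (\<Sum>j \<in> {1..N}. - v j)"
      using \<sigma> v by (intro sum_mono2) auto
    then show ?thesis
      by (simp add: sum_negf)
  qed
  also have "(\<Sum>x \<in> {1..n}. u x) + (\<Sum>j \<in> \<sigma> ` {1..n}. v j) = (\<Sum>x \<in> {1..n}. u x + v (\<sigma> x))"
    using \<sigma>(1) by (simp add: sum.distrib sum.reindex)
  also have "\<dots> \<le> (\<Sum>x \<in> {1..n}. a x (\<sigma> x))"
    using M \<sigma>(2) by (intro sum_mono) (simp add: dual_matching_def image_subset_iff)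
  finally show ?thesis
    by simp
qed

end

section \<open>The program\<close>

abbreviation columns :: nexp where "columns \<equiv> NAdd (nreg ''slots'') (NConst 1)"

text \<open>The product \<open>c0 * |T|\<close> is obtained by counting, and the table
  \<open>owner\<close> replaces the division that would recover the sink of a slot. The register
  \<open>capacities\<close> is cell 0 of that array, which holds \<open>c0\<close>.\<close>

definition build_slots :: com where
  "build_slots = for_loop ''j'' (nreg ''num_sinks'')
     (nset ''k'' (NConst 0) ;;
      for_loop ''k'' (nreg ''capacities'')
        (ninc ''slots'' ;; NAssign ''owner'' (nreg ''slots'') (nreg ''j'')))"

definition clear_used :: com where
  "clear_used = (nset ''j'' (NConst 0) ;;
     for_loop ''j'' columns (NAssign ''used'' (nreg ''j'') (NConst 0)))"

text \<open>Costs are recomputed on demand instead of being stored as a matrix. Rows are numbered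
  from 1 and sources from 0, hence the subtraction.\<close>

definition distance_exp :: rexp where
  "distance_exp =
     (let dx = RSub (RCell ''source_x'' (NSub (nreg ''i'') (NConst 1)))
                 (RCell ''sink_x'' (NCell ''owner'' (nreg ''j'')));
          dy = RSub (RCell ''source_y'' (NSub (nreg ''i'') (NConst 1)))
                 (RCell ''sink_y'' (NCell ''owner'' (nreg ''j'')))
      in RSqrt (RAdd (RMul dx dx) (RMul dy dy)))"

text \<open>The value 0 of \<open>best\<close> means that no candidate has been seen yet; the loop
  starts at column 1, so 0 is never a candidate.\<close>

definition relax_body :: com where
  "relax_body =
     Cond (NLess (NCell ''used'' (nreg ''j'')) (NConst 1))
       (rset ''x'' (RSub (RSub distance_exp (RCell ''u'' (nreg ''i''))) (RCell ''v'' (nreg ''j''))) ;;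
        Cond (BOr (NLess (nreg ''cur'') (NConst 1)) (RLess (rreg ''x'') (RCell ''slack'' (nreg ''j''))))
          (RAssign ''slack'' (nreg ''j'') (rreg ''x'') ;; NAssign ''prev'' (nreg ''j'') (nreg ''cur''))
          Skip ;;
        Cond (BOr (NLess (nreg ''best'') (NConst 1))
               (RLess (RCell ''slack'' (nreg ''j'')) (RCell ''slack'' (nreg ''best''))))
          (nset ''best'' (nreg ''j''))
          Skip)
       Skip"

definition relax_init :: com where
  "relax_init = (NAssign ''used'' (nreg ''cur'') (NConst 1) ;;
     nset ''i'' (NCell ''mate'' (nreg ''cur'')) ;;
     nset ''best'' (NConst 0) ;; nset ''j'' (NConst 1))"

definition relax :: com where
  "relax = (relax_init ;; for_loop ''j'' columns relax_body)"

text \<open>A row potential is addressed through the column matched to the row. Column 0 takes part,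
  since it holds the row being inserted.\<close>

definition shift_body :: com where
  "shift_body =
     Cond (NLess (NCell ''used'' (nreg ''j'')) (NConst 1))
       (RAssign ''slack'' (nreg ''j'') (RSub (RCell ''slack'' (nreg ''j'')) (rreg ''delta'')))
       (RAssign ''u'' (NCell ''mate'' (nreg ''j''))
          (RAdd (RCell ''u'' (NCell ''mate'' (nreg ''j''))) (rreg ''delta'')) ;;
        RAssign ''v'' (nreg ''j'') (RSub (RCell ''v'' (nreg ''j'')) (rreg ''delta'')))"

definition shift :: com where
  "shift = ((rset ''delta'' (RCell ''slack'' (nreg ''best'')) ;;
      nset ''cur'' (nreg ''best'') ;; nset ''j'' (NConst 0)) ;;
     for_loop ''j'' columns shift_body)"

definition search_loop :: com where
  "search_loop = While (NLess (NConst 0) (NCell ''mate'' (nreg ''cur''))) (relax ;; shift)"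

definition augment :: com where
  "augment = While (NLess (NConst 0) (nreg ''cur''))
     (nset ''k'' (NCell ''prev'' (nreg ''cur'')) ;;
      NAssign ''mate'' (nreg ''cur'') (NCell ''mate'' (nreg ''k'')) ;;
      nset ''cur'' (nreg ''k''))"

definition insert_row :: com where
  "insert_row = ((NAssign ''mate'' (NConst 0) (nreg ''row'') ;; nset ''cur'' (NConst 0)) ;;
     clear_used ;; search_loop ;; augment)"

definition write_parents :: com where
  "write_parents = (nset ''j'' (NConst 1) ;;
     for_loop ''j'' columns
       (Cond (NLess (NConst 0) (NCell ''mate'' (nreg ''j'')))
          (NAssign ''parent'' (NSub (NCell ''mate'' (nreg ''j'')) (NConst 1))
             (NCell ''owner'' (nreg ''j'')))
          Skip))"

text \<open>In the infeasible case \<open>feasible\<close> keeps its initial value 0. The output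
  cell \<open>num_steiner\<close> is 0 in both cases, as no part of the program writes to
  it.\<close>

definition hungarian :: com where
  "hungarian = (build_slots ;;
     Cond (NLess (nreg ''slots'') (nreg ''num_sources'')) Skip
       ((nset ''feasible'' (NConst 1) ;; nset ''row'' (NConst 1)) ;;
        for_loop ''row'' (NAdd (nreg ''num_sources'') (NConst 1)) insert_row ;;
        write_parents))"

lemma writes [simp]:
  "nwrites build_slots = {''j'', ''k'', ''slots'', ''owner''}" "rwrites build_slots = {}"
  "nwrites clear_used = {''j'', ''used''}" "rwrites clear_used = {}"
  "nwrites relax_body = {''prev'', ''best''}" "rwrites relax_body = {''x'', ''slack''}"
  "nwrites relax_init = {''used'', ''i'', ''best'', ''j''}" "rwrites relax_init = {}"
  "nwrites relax = {''used'', ''i'', ''best'', ''j'', ''prev''}" "rwrites relax = {''x'', ''slack''}"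
  "nwrites shift_body = {}" "rwrites shift_body = {''u'', ''v'', ''slack''}"
  "nwrites shift = {''cur'', ''j''}" "rwrites shift = {''delta'', ''u'', ''v'', ''slack''}"
  "nwrites search_loop = {''used'', ''i'', ''best'', ''j'', ''prev'', ''cur''}"
  "rwrites search_loop = {''x'', ''slack'', ''delta'', ''u'', ''v''}"
  "nwrites augment = {''k'', ''mate'', ''cur''}" "rwrites augment = {}"
  "nwrites insert_row = {''mate'', ''cur'', ''j'', ''used'', ''i'', ''best'', ''prev'', ''k''}"
  "rwrites insert_row = {''x'', ''slack'', ''delta'', ''u'', ''v''}"
  "nwrites write_parents = {''j'', ''parent''}" "rwrites write_parents = {}"
  by (auto simp: build_slots_def clear_used_def relax_body_def relax_init_def relax_def
      shift_body_def shift_def search_loop_def augment_def insert_row_def write_parents_def)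

lemma exec_times:
  "exec_time relax_init \<le> 20" "exec_time relax_body \<le> 150" "exec_time shift_body \<le> 50"
  by (simp_all add: relax_init_def relax_body_def shift_body_def distance_exp_def Let_def)

lemma loop_free_bodies:
  "loop_free relax_init" "loop_free relax_body" "loop_free shift_body"
  by (simp_all add: relax_init_def relax_body_def shift_body_def)

section \<open>Correctness and running time of the program\<close>

locale solvable_instance =
  fixes I :: flamecast and n N c0 :: nat and a :: "nat \<Rightarrow> nat \<Rightarrow> real"
  defines "n \<equiv> num_sources I" and "c0 \<equiv> cap I 0" and "N \<equiv> cap I 0 * num_sinks I"
    and "a \<equiv> \<lambda>x j. norm (source_pos I ! (x - 1) - sink_pos I ! ((j - 1) div c0))"
  assumes inst: "flamecast_instance I" and n_le_N: "n \<le> N"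
begin

sublocale assignment_problem n N a
  using n_le_N by unfold_locales (simp_all add: a_def)

lemma c0_pos: "c0 > 0"
proof -
  have "cap I 0 \<in> set (capacities I)"
    using inst by (auto simp: flamecast_instance_def cap_def intro!: nth_mem)
  then show ?thesis
    using inst by (force simp: c0_def flamecast_instance_def)
qed

lemma owner_less: "j \<in> {1..N} \<Longrightarrow> (j - 1) div c0 < num_sinks I"
  using c0_pos by (auto simp: N_def c0_def less_mult_imp_div_less mult.commute)

text \<open>The data that stay fixed once the slots are built; all later parts of the program write
  to other arrays.\<close>

definition ready :: "state \<Rightarrow> bool" where
  "ready s \<longleftrightarrow> nmem s ''slots'' 0 = N \<and> nmem s ''num_sources'' 0 = n \<and>
     (\<forall>j \<in> {1..N}. nmem s ''owner'' j = (j - 1) div c0) \<and>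
     (\<forall>x \<in> {''source_x'', ''source_y'', ''sink_x'', ''sink_y''}. rmem s x = rmem (input_state I) x)"

lemma ready_agree:
  assumes "ready s" "agree A B s s'" "''slots'' \<notin> A" "''num_sources'' \<notin> A" "''owner'' \<notin> A"
    "''source_x'' \<notin> B" "''source_y'' \<notin> B" "''sink_x'' \<notin> B" "''sink_y'' \<notin> B"
  shows "ready s'"
  using assms by (auto simp: ready_def agree_def)

lemma ready_bound: "ready s \<Longrightarrow> nval columns s = Suc N"
  by (simp add: ready_def)

lemma rval_distance:
  assumes "ready s" "nmem s ''i'' 0 \<in> {1..n}" "nmem s ''j'' 0 \<in> {1..N}"
  shows "rval distance_exp s = a (nmem s ''i'' 0) (nmem s ''j'' 0)"
proof -
  let ?x = "nmem s ''i'' 0" and ?j = "nmem s ''j'' 0"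
  have "?x - 1 < length (source_pos I)" "(?j - 1) div c0 < length (sink_pos I)"
    using assms owner_less by (auto simp: n_def num_sources_def num_sinks_def)
  moreover have "nmem s ''owner'' ?j = (?j - 1) div c0"
    using assms by (simp add: ready_def)
  ultimately show ?thesis
    using assms(1)
    by (simp add: distance_exp_def Let_def ready_def input_state_def real_array_def a_def
        norm_vec_def L2_set_def UNIV_2 power2_eq_square)
qed

text \<open>Only columns up to \<open>N\<close> count, since the loop that clears the marks stops
  there.\<close>

definition used_set :: "state \<Rightarrow> nat set" where
  "used_set s = {j. j \<le> N \<and> nmem s ''used'' j \<noteq> 0}"

abbreviation relaxed_in :: "state \<Rightarrow> state \<Rightarrow> nat \<Rightarrow> bool" where
  "relaxed_in s s' \<equiv> relaxed (nmem s ''cur'' 0) (used_set s) (nmem s ''mate'') (rmem s ''u'')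
     (rmem s ''v'') (nmem s ''prev'') (rmem s ''slack'') (nmem s' ''prev'') (rmem s' ''slack'')"

text \<open>Entries from \<open>k\<close> on are recorded as untouched, because the comparison at
  column \<open>k\<close> must see the slack from before the pass.\<close>

definition relax_inv :: "state \<Rightarrow> nat \<Rightarrow> state \<Rightarrow> bool" where
  "relax_inv s k s' \<longleftrightarrow>
     (\<forall>j \<in> {1..<k}. relaxed_in s s' j) \<and>
     (\<forall>j \<ge> k. rmem s' ''slack'' j = rmem s ''slack'' j \<and> nmem s' ''prev'' j = nmem s ''prev'' j) \<and>
     (if {1..<k} - used_set s = {} then nmem s' ''best'' 0 = 0
      else nmem s' ''best'' 0 \<in> {1..<k} - used_set s \<and>
        (\<forall>j \<in> {1..<k} - used_set s. rmem s' ''slack'' (nmem s' ''best'' 0) \<le> rmem s' ''slack'' j))"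

lemma relax_inv_nupdate_j: "relax_inv s k (nupdate ''j'' 0 l s') = relax_inv s k s'"
  by (simp add: relax_inv_def)

lemma relax_inv_step:
  assumes k: "1 \<le> k" "k \<le> N" and j: "nmem s' ''j'' 0 = k" and inv: "relax_inv s k s'"
    and ag: "agree {''j'', ''prev'', ''best''} {''x'', ''slack''} s s'"
    and rd: "ready s" and i: "nmem s ''i'' 0 = nmem s ''mate'' (nmem s ''cur'' 0)"
    and x: "nmem s ''i'' 0 \<in> {1..n}"
  shows "nmem (exec relax_body s') ''j'' 0 = k"
    and "relax_inv s (Suc k) (nupdate ''j'' 0 (Suc k) (exec relax_body s'))"
proof -
  note eqs = agree_nmem[OF ag] agree_rmem[OF ag]
  have rd': "ready s'"
    by (rule ready_agree[OF rd ag]) simp_all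
  have dist: "rval distance_exp s' = a (nmem s ''mate'' (nmem s ''cur'' 0)) k"
    using rval_distance[OF rd'] i x k j by (simp add: eqs)
  have ivl: "{1..<Suc k} = insert k {1..<k}"
    using k by auto
  show "nmem (exec relax_body s') ''j'' 0 = k"
    using j by (simp add: relax_body_def)
  show "relax_inv s (Suc k) (nupdate ''j'' 0 (Suc k) (exec relax_body s'))"
  proof (cases "k \<in> used_set s")
    case True
    then have "exec relax_body s' = s'"
      using j by (simp add: relax_body_def used_set_def eqs)
    moreover have "relax_inv s (Suc k) s'"
    proof -
      have "relaxed_in s s' k"
        using True inv by (simp add: relaxed_def relax_inv_def)
      then have "\<forall>j \<in> {1..<Suc k}. relaxed_in s s' j"
        using inv unfolding relax_inv_def ivl by blast
      moreover have "\<forall>j \<ge> Suc k. rmem s' ''slack'' j = rmem s ''slack'' j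
          \<and> nmem s' ''prev'' j = nmem s ''prev'' j"
        using inv unfolding relax_inv_def by (meson Suc_leD)
      moreover have D: "{1..<Suc k} - used_set s = {1..<k} - used_set s"
        using True ivl by auto
      ultimately show ?thesis
        using inv unfolding relax_inv_def D by meson
    qed
    ultimately show ?thesis
      by (simp only: relax_inv_nupdate_j)
  next
    case False
    define x where "x = a (nmem s ''mate'' (nmem s ''cur'' 0)) k
      - rmem s ''u'' (nmem s ''mate'' (nmem s ''cur'' 0)) - rmem s ''v'' k"
    define better where "better \<longleftrightarrow> nmem s ''cur'' 0 = 0 \<or> x < rmem s ''slack'' k"
    define y where "y = (if better then x else rmem s ''slack'' k)"
    define b where "b = nmem s' ''best'' 0"
    define b' where "b' = (if b = 0 \<or> y < rmem s' ''slack'' b then k else b)"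
    have b: "if {1..<k} - used_set s = {} then b = 0 else b \<in> {1..<k} - used_set s \<and>
        (\<forall>j \<in> {1..<k} - used_set s. rmem s' ''slack'' b \<le> rmem s' ''slack'' j)"
      using inv unfolding relax_inv_def b_def by blast
    \<comment> \<open>The minimiser so far differs from \<open>k\<close>, so overwriting the slack
      of \<open>k\<close> does not disturb the value it is compared with.\<close>
    then have bk: "b \<noteq> k"
      using k by (auto split: if_splits)
    have sk: "rmem s' ''slack'' k = rmem s ''slack'' k" "nmem s' ''prev'' k = nmem s ''prev'' k"
      using inv by (simp_all add: relax_inv_def)
    define s2 where "s2 = nupdate ''j'' 0 (Suc k) (exec relax_body s')"
    have unused: "nmem s' ''used'' k = 0"
      using False k by (simp add: used_set_def eqs)
    have t: "rmem s2 ''slack'' = (rmem s' ''slack'')(k := y)"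
        "nmem s2 ''prev'' = (nmem s' ''prev'')(k := if better then nmem s ''cur'' 0 else nmem s ''prev'' k)"
        "nmem s2 ''best'' 0 = b'"
      using unused bk sk i j
      by (auto simp: s2_def fun_eq_iff relax_body_def dist eqs better_def x_def y_def b_def b'_def)
    have "relaxed_in s s2 j" if "j \<in> {1..<Suc k}" for j
    proof (cases "j = k")
      case True
      then show ?thesis
        using False by (simp add: relaxed_def Let_def t y_def better_def x_def)
    next
      case j: False
      then have "relaxed_in s s' j"
        using inv that by (simp add: relax_inv_def)
      then show ?thesis
        using j by (simp add: relaxed_def Let_def t)
    qed
    moreover have "rmem s2 ''slack'' j = rmem s ''slack'' j \<and> nmem s2 ''prev'' j = nmem s ''prev'' j"
      if "j \<ge> Suc k" for j
      using inv that by (simp add: relax_inv_def t)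
    moreover have "b' \<in> {1..<Suc k} - used_set s \<and>
        (\<forall>j \<in> {1..<Suc k} - used_set s. rmem s2 ''slack'' b' \<le> rmem s2 ''slack'' j)"
    proof (cases "{1..<k} - used_set s = {}")
      case True
      then have "b' = k"
        using b by (simp add: b'_def)
      moreover have "{1..<Suc k} - used_set s = {k}"
        unfolding ivl using True False by blast
      ultimately show ?thesis
        by simp
    next
      case ne: False
      then have b1: "b \<in> {1..<k} - used_set s"
          "\<And>j. j \<in> {1..<k} - used_set s \<Longrightarrow> rmem s' ''slack'' b \<le> rmem s' ''slack'' j"
        using b by auto
      show ?thesis
      proof (cases "y < rmem s' ''slack'' b")
        case True
        then have b'k: "b' = k"
          by (simp add: b'_def)
        have "y \<le> rmem s' ''slack'' j" if "j \<in> {1..<k} - used_set s" for j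
          using True b1(2)[OF that] by simp
        then show ?thesis
          unfolding b'k t(1) ivl using False by auto
      next
        case nless: False
        then have b'b: "b' = b"
          using b1(1) by (auto simp: b'_def)
        show ?thesis
          unfolding b'b t(1) ivl using b1 nless bk by auto
      qed
    qed
    moreover have ne: "{1..<Suc k} - used_set s \<noteq> {}"
      using False ivl by auto
    ultimately show ?thesis
      unfolding s2_def[symmetric] relax_inv_def t(3) if_not_P[OF ne] by blast
  qed
qed

lemma halts_relax:
  assumes rd: "ready s" and c: "nmem s ''cur'' 0 \<le> N"
    and row: "nmem s ''mate'' (nmem s ''cur'' 0) \<in> {1..n}"
  defines "U \<equiv> insert (nmem s ''cur'' 0) (used_set s)"
  assumes ne: "{1..N} - U \<noteq> {}"
  shows "halts relax s (200 * (N + 1)) (\<lambda>s'. used_set s' = U \<and>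
     (\<forall>j \<in> {1..N}. relaxed (nmem s ''cur'' 0) U (nmem s ''mate'') (rmem s ''u'')
       (rmem s ''v'') (nmem s ''prev'') (rmem s ''slack'') (nmem s' ''prev'') (rmem s' ''slack'') j) \<and>
     nmem s' ''best'' 0 \<in> {1..N} - U \<and>
     (\<forall>j \<in> {1..N} - U. rmem s' ''slack'' (nmem s' ''best'' 0) \<le> rmem s' ''slack'' j))"
    (is "halts _ _ _ ?Q")
proof -
  let ?s = "exec relax_init s"
  have init: "nmem ?s ''j'' 0 = 1" "nmem ?s ''best'' 0 = 0" "nmem ?s ''cur'' = nmem s ''cur''"
      "nmem ?s ''i'' 0 = nmem s ''mate'' (nmem s ''cur'' 0)" "nmem ?s ''mate'' = nmem s ''mate''"
      "nmem ?s ''prev'' = nmem s ''prev''" "rmem ?s = rmem s"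
      "nmem ?s ''slots'' = nmem s ''slots''" "nmem ?s ''num_sources'' = nmem s ''num_sources''"
      "nmem ?s ''owner'' = nmem s ''owner''"
    by (simp_all add: relax_init_def fun_eq_iff)
  have U: "used_set ?s = U"
    using c by (auto simp: used_set_def U_def relax_init_def)
  have rd1: "ready ?s"
    using rd by (simp add: ready_def init)
  \<comment> \<open>An iteration costs 150 for the body, 4 for evaluating the loop bound and 10 for
    the loop itself.\<close>
  have "halts (relax_init ;; for_loop ''j'' columns relax_body) s (20 + (N + 1) * 164) ?Q"
  proof (rule halts_Seq)
    show "halts relax_init s 20 (\<lambda>s'. s' = ?s)"
      using exec_times(1) loop_free_bodies(1) by (intro halts_exec) auto
  next
    fix s1 assume s1: "s1 = ?s"
    have "halts (for_loop ''j'' columns relax_body) ?s ((Suc N - 1) * (150 + ntime columns + 10) + ntime columns + 4)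
        (relax_inv ?s (Suc N))"
    proof (rule halts_for_loop)
      show "relax_inv ?s 1 ?s"
        by (simp add: relax_inv_def init)
    next
      fix k s' assume ag: "agree (insert ''j'' (nwrites relax_body)) (rwrites relax_body) ?s s'"
      show "nval columns s' = Suc N"
        by (intro ready_bound ready_agree[OF rd1 ag]) simp_all
    next
      fix k s' assume *: "1 \<le> k" "k < Suc N" "nmem s' ''j'' 0 = k" "relax_inv ?s k s'"
        "agree (insert ''j'' (nwrites relax_body)) (rwrites relax_body) ?s s'"
      show "halts relax_body s' 150
          (\<lambda>s''. nmem s'' ''j'' 0 = k \<and> relax_inv ?s (Suc k) (nupdate ''j'' 0 (Suc k) s''))"
        using relax_inv_step[of k s' ?s] * rd1 row exec_times(2) loop_free_bodies(2)
        by (intro halts_exec) (simp_all add: init)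
    qed (simp_all add: init)
    then show "halts (for_loop ''j'' columns relax_body) s1 ((N + 1) * 164) ?Q"
      unfolding s1
    proof (rule halts_mono)
      fix s' assume ag: "agree (nwrites (for_loop ''j'' columns relax_body))
          (rwrites (for_loop ''j'' columns relax_body)) ?s s'"
        and inv: "relax_inv ?s (Suc N) s'"
      have "used_set s' = U"
        unfolding U[symmetric] by (simp add: used_set_def agree_nmem[OF ag])
      then show "?Q s'"
        using inv ne unfolding relax_inv_def U init
        by (auto simp: atLeastLessThanSuc_atLeastAtMost)
    qed simp
  qed
  then show ?thesis
    unfolding relax_def by (rule halts_mono) auto
qed

definition shift_inv :: "state \<Rightarrow> nat \<Rightarrow> state \<Rightarrow> bool" where
  "shift_inv s k s' \<longleftrightarrow>
     (let U = used_set s \<inter> {..<k}; \<delta> = rmem s ''delta'' 0 in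
      (\<forall>x. rmem s' ''u'' x = rmem s ''u'' x + (if x \<in> nmem s ''mate'' ` U then \<delta> else 0)) \<and>
      (\<forall>j. rmem s' ''v'' j = rmem s ''v'' j - (if j \<in> U then \<delta> else 0)) \<and>
      (\<forall>j. rmem s' ''slack'' j = rmem s ''slack'' j - (if j < k \<and> j \<notin> U then \<delta> else 0)))"

lemma shift_inv_step:
  assumes k: "k \<le> N" and j: "nmem s' ''j'' 0 = k" and inv: "shift_inv s k s'"
    and ag: "agree {''j''} {''u'', ''v'', ''slack''} s s'"
    and inj: "inj_on (nmem s ''mate'') (used_set s)"
  shows "shift_inv s (Suc k) (nupdate ''j'' 0 (Suc k) (exec shift_body s'))"
proof -
  note eqs = agree_nmem[OF ag] agree_rmem[OF ag]
  let ?U = "used_set s" and ?m = "nmem s ''mate''"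
  have used: "nmem s' ''used'' k = 0 \<longleftrightarrow> k \<notin> ?U"
    using k by (simp add: used_set_def eqs)
  show ?thesis
  proof (cases "k \<in> ?U")
    case True
    have U: "?U \<inter> {..<Suc k} = insert k (?U \<inter> {..<k})"
      using True by auto
    \<comment> \<open>Distinct scanned columns hold distinct rows, so the row of \<open>k\<close>
      has not been raised before in this pass.\<close>
    have new: "?m k \<notin> ?m ` (?U \<inter> {..<k})"
      using inj True by (auto dest: inj_onD)
    show ?thesis
      using inv True new used j unfolding shift_inv_def U Let_def
      by (auto simp: shift_body_def eqs)
  next
    case False
    have U: "?U \<inter> {..<Suc k} = ?U \<inter> {..<k}"
      using False by (auto simp: less_Suc_eq)
    show ?thesis
      using inv False used j unfolding shift_inv_def U Let_def
      by (auto simp: shift_body_def eqs less_Suc_eq)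
  qed
qed

lemma halts_shift:
  assumes rd: "ready s" and inj: "inj_on (nmem s ''mate'') (used_set s)"
  shows "halts shift s (200 * (N + 1)) (\<lambda>s'. nmem s' ''cur'' 0 = nmem s ''best'' 0 \<and>
     (let U = used_set s; \<delta> = rmem s ''slack'' (nmem s ''best'' 0) in
      (\<forall>x. rmem s' ''u'' x = rmem s ''u'' x + (if x \<in> nmem s ''mate'' ` U then \<delta> else 0)) \<and>
      (\<forall>j \<le> N. rmem s' ''v'' j = rmem s ''v'' j - (if j \<in> U then \<delta> else 0)) \<and>
      (\<forall>j \<le> N. rmem s' ''slack'' j = rmem s ''slack'' j - (if j \<in> U then 0 else \<delta>))))"
    (is "halts _ _ _ ?Q")
proof -
  let ?init = "rset ''delta'' (RCell ''slack'' (nreg ''best'')) ;;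
      nset ''cur'' (nreg ''best'') ;; nset ''j'' (NConst 0)"
  let ?s = "exec ?init s"
  have init: "nmem ?s ''j'' 0 = 0" "nmem ?s ''cur'' 0 = nmem s ''best'' 0"
      "nmem ?s ''mate'' = nmem s ''mate''" "nmem ?s ''used'' = nmem s ''used''"
      "rmem ?s ''u'' = rmem s ''u''" "rmem ?s ''v'' = rmem s ''v''" "rmem ?s ''slack'' = rmem s ''slack''"
      "rmem ?s ''delta'' 0 = rmem s ''slack'' (nmem s ''best'' 0)"
    by (simp_all add: fun_eq_iff)
  have U: "used_set ?s = used_set s"
    by (simp only: used_set_def init)
  have rd1: "ready ?s"
    using rd by (simp add: ready_def fun_eq_iff)
  have "halts (?init ;; for_loop ''j'' columns shift_body) s (20 + (N + 2) * 64) ?Q"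
  proof (rule halts_Seq)
    show "halts ?init s 20 (\<lambda>s'. s' = ?s)"
      by (intro halts_exec) simp_all
  next
    fix s1 assume s1: "s1 = ?s"
    have "halts (for_loop ''j'' columns shift_body) ?s ((Suc N - 0) * (50 + ntime columns + 10) + ntime columns + 4)
        (shift_inv ?s (Suc N))"
    proof (rule halts_for_loop)
      show "shift_inv ?s 0 ?s"
        by (simp add: shift_inv_def)
    next
      fix k s' assume ag: "agree (insert ''j'' (nwrites shift_body)) (rwrites shift_body) ?s s'"
      show "nval columns s' = Suc N"
        by (intro ready_bound ready_agree[OF rd1 ag]) simp_all
    next
      fix k s' assume *: "k < Suc N" "nmem s' ''j'' 0 = k" "shift_inv ?s k s'"
        "agree (insert ''j'' (nwrites shift_body)) (rwrites shift_body) ?s s'"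
      have "shift_inv ?s (Suc k) (nupdate ''j'' 0 (Suc k) (exec shift_body s'))"
        by (rule shift_inv_step) (use * inj U init(3) in auto)
      then show "halts shift_body s' 50
          (\<lambda>s''. nmem s'' ''j'' 0 = k \<and> shift_inv ?s (Suc k) (nupdate ''j'' 0 (Suc k) s''))"
        using *(2) exec_times(3) loop_free_bodies(3)
        by (intro halts_exec) (simp_all add: shift_body_def)
    qed (simp_all add: init)
    then show "halts (for_loop ''j'' columns shift_body) s1 ((N + 2) * 64) ?Q"
      unfolding s1
    proof (rule halts_mono)
      fix s' assume ag: "agree (nwrites (for_loop ''j'' columns shift_body))
          (rwrites (for_loop ''j'' columns shift_body)) ?s s'"
        and inv: "shift_inv ?s (Suc N) s'"
      have cur: "nmem s' ''cur'' 0 = nmem s ''best'' 0"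
        using init(2) by (subst agree_nmem[OF ag]) simp_all
      have "used_set s \<inter> {..<Suc N} = used_set s"
        by (auto simp: used_set_def)
      then show "?Q s'"
        using inv cur unfolding shift_inv_def U init Let_def by auto
    qed simp
  qed
  then show ?thesis
    unfolding shift_def by (rule halts_mono) auto
qed

section \<open>Search, augmentation and insertion of a row\<close>

abbreviation searching :: "nat \<Rightarrow> state \<Rightarrow> bool" where
  "searching r s \<equiv> search r (used_set s) (nmem s ''cur'' 0) (nmem s ''mate'') (rmem s ''u'')
     (rmem s ''v'') (nmem s ''prev'') (rmem s ''slack'')"

text \<open>Each scan marks a column that was unmarked, so the number of unmarked columns among the
  \<open>N + 1\<close> serves as the measure of the loop.\<close>

lemma halts_search_step:
  assumes rd: "ready s" and S: "searching r s" and r: "r \<le> n"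
    and nz: "nmem s ''mate'' (nmem s ''cur'' 0) \<noteq> 0"
  shows "halts (relax ;; shift) s (400 * (N + 1))
    (\<lambda>s'. searching r s' \<and> Suc N - card (used_set s') < Suc N - card (used_set s))"
proof -
  let ?c = "nmem s ''cur'' 0" and ?p = "nmem s ''mate''"
  let ?U = "insert ?c (used_set s)"
  note nx = search_next[OF S r nz]
  have row: "?p ?c \<in> {1..n}"
    using nx(1) r by auto
  have c: "?c \<le> N"
    using S by (simp add: search_def)
  have "halts (relax ;; shift) s (200 * (N + 1) + 200 * (N + 1))
    (\<lambda>s'. searching r s' \<and> Suc N - card (used_set s') < Suc N - card (used_set s))"
  proof (rule halts_Seq[OF halts_relax[OF rd c row nx(3)]], elim conjE)
    fix s1
    assume ag1: "agree (nwrites relax) (rwrites relax) s s1"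
      and U1: "used_set s1 = ?U"
      and rel: "\<forall>j \<in> {1..N}. relaxed ?c ?U ?p (rmem s ''u'') (rmem s ''v'') (nmem s ''prev'')
        (rmem s ''slack'') (nmem s1 ''prev'') (rmem s1 ''slack'') j"
      and best: "nmem s1 ''best'' 0 \<in> {1..N} - ?U"
        "\<forall>j \<in> {1..N} - ?U. rmem s1 ''slack'' (nmem s1 ''best'' 0) \<le> rmem s1 ''slack'' j"
    have p1: "nmem s1 ''mate'' = ?p" and u1: "rmem s1 ''u'' = rmem s ''u''"
      and v1: "rmem s1 ''v'' = rmem s ''v''"
      by (simp_all add: agree_nmem[OF ag1] agree_rmem[OF ag1])
    have rd1: "ready s1"
      by (rule ready_agree[OF rd ag1]) simp_all
    have "inj_on (nmem s1 ''mate'') (used_set s1)"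
      unfolding p1 U1 by (rule nx(2))
    then show "halts shift s1 (200 * (N + 1))
        (\<lambda>s'. searching r s' \<and> Suc N - card (used_set s') < Suc N - card (used_set s))"
    proof (rule halts_mono[OF halts_shift[OF rd1] order_refl], unfold Let_def, elim conjE)
      fix s2
      let ?d = "rmem s1 ''slack'' (nmem s1 ''best'' 0)"
      assume ag2: "agree (nwrites shift) (rwrites shift) s1 s2"
        and cur: "nmem s2 ''cur'' 0 = nmem s1 ''best'' 0"
        and u2: "\<forall>x. rmem s2 ''u'' x =
          rmem s1 ''u'' x + (if x \<in> nmem s1 ''mate'' ` used_set s1 then ?d else 0)"
        and v2: "\<forall>j \<le> N. rmem s2 ''v'' j = rmem s1 ''v'' j - (if j \<in> used_set s1 then ?d else 0)"
        and m2: "\<forall>j \<le> N. rmem s2 ''slack'' j =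
          rmem s1 ''slack'' j - (if j \<in> used_set s1 then 0 else ?d)"
      have p2: "nmem s2 ''mate'' = ?p" and w2: "nmem s2 ''prev'' = nmem s1 ''prev''"
        and U2: "used_set s2 = ?U"
        using p1 U1 by (simp_all add: agree_nmem[OF ag2] used_set_def)
      have "searching r s2"
        unfolding p2 w2 U2 cur
        \<comment> \<open>\<open>m'\<close> stands for the slacks after the pass over the columns
          and before the shift; their minimum is the amount of the shift.\<close>
        by (rule search_step[OF S r nz, where m' = "rmem s1 ''slack''"])
          (use rel best u2 v2 m2 in \<open>simp_all only: p1 u1 v1 U1\<close>)
      moreover have "card ?U \<le> Suc N"
        using card_mono[OF _ nx(6)] by simp
      ultimately show "searching r s2 \<and> Suc N - card (used_set s2) < Suc N - card (used_set s)"
        using nx(4,5) unfolding U2 by simp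
    qed
  qed
  then show ?thesis
    by simp
qed

text \<open>At most \<open>N + 1\<close> scans of linear cost each: Dijkstra's algorithm without a
  priority queue.\<close>

lemma halts_search_loop:
  assumes rd: "ready s" and S: "searching r s" and r: "r \<le> n"
  shows "halts search_loop s (500 * (N + 1) ^ 2)
    (\<lambda>s'. searching r s' \<and> nmem s' ''mate'' (nmem s' ''cur'' 0) = 0)"
proof -
  let ?b = "NLess (NConst 0) (NCell ''mate'' (nreg ''cur''))"
  have "halts search_loop s
      ((Suc N - card (used_set s)) * (400 * (N + 1) + btime ?b + 1) + btime ?b + 1)
      (\<lambda>s'. searching r s' \<and> \<not> bval ?b s')"
    unfolding search_loop_def
  proof (rule halts_While)
    show "searching r s"
      by (rule S)
  next
    fix s' assume "searching r s'" "bval ?b s'"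
      and ag: "agree (nwrites (relax ;; shift)) (rwrites (relax ;; shift)) s s'"
    moreover have "ready s'"
      by (rule ready_agree[OF rd ag]) simp_all
    ultimately show "halts (relax ;; shift) s' (400 * (N + 1))
        (\<lambda>s''. searching r s'' \<and> Suc N - card (used_set s'') < Suc N - card (used_set s'))"
      using r by (intro halts_search_step) simp_all
  qed
  then show ?thesis
  proof (rule halts_mono)
    have "(Suc N - card (used_set s)) * (400 * (N + 1) + btime ?b + 1) + btime ?b + 1
        \<le> (N + 1) * (400 * (N + 1) + btime ?b + 1) + btime ?b + 1"
      by (intro add_right_mono mult_right_mono) auto
    also have "\<dots> \<le> 500 * (N + 1) ^ 2"
      by (simp add: power2_eq_square algebra_simps)
    finally show "(Suc N - card (used_set s)) * (400 * (N + 1) + btime ?b + 1) + btime ?b + 1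
        \<le> 500 * (N + 1) ^ 2" .
  qed simp
qed

text \<open>The rank of the current hole is the loop measure, so the walk back takes at most
  \<open>N + 1\<close> steps. It ends with the hole at column 0, the form required between
  insertions.\<close>

lemma halts_augment:
  assumes A: "augmenting r (nmem s ''cur'' 0) V (nmem s ''mate'') (rmem s ''u'') (rmem s ''v'')
      (nmem s ''prev'') \<rho>" and \<rho>: "\<rho> (nmem s ''cur'' 0) \<le> Suc N"
  shows "halts augment s (40 * (N + 1))
    (\<lambda>s'. dual_matching 0 r (nmem s' ''mate'') (rmem s' ''u'') (rmem s' ''v''))"
proof -
  let ?c = "nset ''k'' (NCell ''prev'' (nreg ''cur'')) ;;
      NAssign ''mate'' (nreg ''cur'') (NCell ''mate'' (nreg ''k'')) ;;
      nset ''cur'' (nreg ''k'')"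
  let ?b = "NLess (NConst 0) (nreg ''cur'')"
  let ?Inv = "\<lambda>s'. augmenting r (nmem s' ''cur'' 0) V (nmem s' ''mate'') (rmem s ''u'') (rmem s ''v'')
      (nmem s ''prev'') \<rho>"
  have "halts augment s (\<rho> (nmem s ''cur'' 0) * (15 + btime ?b + 1) + btime ?b + 1)
      (\<lambda>s'. ?Inv s' \<and> \<not> bval ?b s')"
    unfolding augment_def
  proof (rule halts_While)
    show "?Inv s"
      by (rule A)
  next
    fix s' assume inv: "?Inv s'" and b: "bval ?b s'"
      and ag: "agree (nwrites ?c) (rwrites ?c) s s'"
    let ?h = "nmem s' ''cur'' 0" and ?w = "nmem s ''prev''"
    have w: "nmem s' ''prev'' = ?w"
      by (simp add: agree_nmem[OF ag])
    have "nmem (exec ?c s') ''cur'' 0 = ?w ?h"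
      by (simp add: w)
    moreover have "nmem (exec ?c s') ''mate'' = (nmem s' ''mate'')(?h := nmem s' ''mate'' (?w ?h))"
      by (auto simp: fun_eq_iff w)
    ultimately have "?Inv (exec ?c s') \<and> \<rho> (nmem (exec ?c s') ''cur'' 0) < \<rho> ?h"
      using augmenting_step[OF inv] b by (simp del: exec.simps)
    then show "halts ?c s' 15 (\<lambda>s''. ?Inv s'' \<and> \<rho> (nmem s'' ''cur'' 0) < \<rho> ?h)"
      by (intro halts_exec) simp_all
  qed
  then show ?thesis
  proof (rule halts_mono)
    have "\<rho> (nmem s ''cur'' 0) * (15 + btime ?b + 1) + btime ?b + 1
        \<le> Suc N * (15 + btime ?b + 1) + btime ?b + 1"
      using \<rho> by (intro add_right_mono mult_right_mono) auto
    then show "\<rho> (nmem s ''cur'' 0) * (15 + btime ?b + 1) + btime ?b + 1 \<le> 40 * (N + 1)"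
      by simp
  next
    fix s' assume ag: "agree (nwrites augment) (rwrites augment) s s'"
      and *: "?Inv s' \<and> \<not> bval ?b s'"
    then have "nmem s' ''cur'' 0 = 0"
      by simp
    then show "dual_matching 0 r (nmem s' ''mate'') (rmem s' ''u'') (rmem s' ''v'')"
      using * unfolding augmenting_def by (simp add: agree_rmem[OF ag])
  qed
qed

lemma halts_clear_used:
  assumes rd: "ready s"
  shows "halts clear_used s (40 * (N + 1)) (\<lambda>s'. used_set s' = {})"
proof -
  let ?c = "NAssign ''used'' (nreg ''j'') (NConst 0)"
  have "halts clear_used s (4 + ((Suc N - 0) * (4 + ntime columns + 10) + ntime columns + 4))
      (\<lambda>s'. \<forall>j < Suc N. nmem s' ''used'' j = 0)"
    unfolding clear_used_def
  proof (rule halts_Seq)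
    show "halts (nset ''j'' (NConst 0)) s 4 (\<lambda>s'. nmem s' ''j'' 0 = 0)"
      by (intro halts_exec) simp_all
  next
    fix s1 assume ag1: "agree (nwrites (nset ''j'' (NConst 0))) (rwrites (nset ''j'' (NConst 0))) s s1"
      and j: "nmem s1 ''j'' 0 = 0"
    have rd1: "ready s1"
      by (rule ready_agree[OF rd ag1]) simp_all
    show "halts (for_loop ''j'' columns ?c) s1
        ((Suc N - 0) * (4 + ntime columns + 10) + ntime columns + 4)
        (\<lambda>s'. \<forall>j < Suc N. nmem s' ''used'' j = 0)"
    proof (rule halts_for_loop[where Inv = "\<lambda>k s'. \<forall>j < k. nmem s' ''used'' j = 0"])
      fix k s' assume ag: "agree (insert ''j'' (nwrites ?c)) (rwrites ?c) s1 s'"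
      show "nval columns s' = Suc N"
        by (intro ready_bound ready_agree[OF rd1 ag]) simp_all
    next
      fix k and s' :: state assume "\<forall>j < k. nmem s' ''used'' j = 0" "nmem s' ''j'' 0 = k"
      then show "halts ?c s' 4 (\<lambda>s''. nmem s'' ''j'' 0 = k \<and>
          (\<forall>j < Suc k. nmem (nupdate ''j'' 0 (Suc k) s'') ''used'' j = 0))"
        by (intro halts_exec) (simp_all add: less_Suc_eq)
    qed (use j in simp_all)
  qed
  then show ?thesis
    by (rule halts_mono) (auto simp: used_set_def)
qed

text \<open>The new row first gets column 0 as a virtual partner, so no row is unmatched during the
  search; search and augmentation then bring the hole back to column 0. The search dominates the
  time.\<close>

lemma halts_insert_row:
  assumes rd: "ready s" and r: "r < n" and row: "nmem s ''row'' 0 = Suc r"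
    and M: "dual_matching 0 r (nmem s ''mate'') (rmem s ''u'') (rmem s ''v'')"
  shows "halts insert_row s (700 * (N + 1) ^ 2)
    (\<lambda>s'. dual_matching 0 (Suc r) (nmem s' ''mate'') (rmem s' ''u'') (rmem s' ''v''))"
    (is "halts _ _ _ ?Q")
proof -
  let ?init = "NAssign ''mate'' (NConst 0) (nreg ''row'') ;; nset ''cur'' (NConst 0)"
  have "halts insert_row s (20 + (40 * (N + 1) + (500 * (N + 1) ^ 2 + 40 * (N + 1)))) ?Q"
    unfolding insert_row_def
  proof (rule halts_Seq)
    show "halts ?init s 20 (\<lambda>s'. nmem s' ''cur'' 0 = 0 \<and>
        nmem s' ''mate'' = (nmem s ''mate'')(0 := Suc r))"
      using row by (intro halts_exec) (auto simp: fun_eq_iff)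
  next
    fix s1 assume ag1: "agree (nwrites ?init) (rwrites ?init) s s1"
      and i1: "nmem s1 ''cur'' 0 = 0 \<and> nmem s1 ''mate'' = (nmem s ''mate'')(0 := Suc r)"
    have rd1: "ready s1"
      by (rule ready_agree[OF rd ag1]) simp_all
    have "dual_matching 0 r (nmem s1 ''mate'') (rmem s1 ''u'') (rmem s1 ''v'')"
      by (rule dual_matching_cong[OF M]) (simp_all add: i1 agree_rmem[OF ag1])
    then have M1: "dual_matching (Suc N) (Suc r) (nmem s1 ''mate'') (rmem s1 ''u'') (rmem s1 ''v'')"
      by (rule dual_matching_add_row) (simp add: i1)
    show "halts (clear_used ;; search_loop ;; augment) s1
        (40 * (N + 1) + (500 * (N + 1) ^ 2 + 40 * (N + 1))) ?Q"
    proof (rule halts_Seq[OF halts_clear_used[OF rd1]])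
      fix s2 assume ag2: "agree (nwrites clear_used) (rwrites clear_used) s1 s2"
        and U: "used_set s2 = {}"
      have rd2: "ready s2"
        by (rule ready_agree[OF rd1 ag2]) simp_all
      have "searching (Suc r) s2"
        using search_init[OF M1] i1
        by (simp add: U agree_nmem[OF ag2] agree_rmem[OF ag2])
      then show "halts (search_loop ;; augment) s2 (500 * (N + 1) ^ 2 + 40 * (N + 1)) ?Q"
      proof (rule halts_Seq[OF halts_search_loop[OF rd2]])
        fix s3 assume "searching (Suc r) s3 \<and> nmem s3 ''mate'' (nmem s3 ''cur'' 0) = 0"
        then obtain \<rho> where "augmenting (Suc r) (nmem s3 ''cur'' 0)
            (insert (nmem s3 ''cur'' 0) (used_set s3)) (nmem s3 ''mate'') (rmem s3 ''u'')
            (rmem s3 ''v'') (nmem s3 ''prev'') \<rho>" "\<rho> (nmem s3 ''cur'' 0) \<le> Suc N"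
          using augmenting_init by blast
        then show "halts augment s3 (40 * (N + 1)) ?Q"
          by (rule halts_augment)
      qed (use r in simp)
    qed
  qed
  then show ?thesis
    by (rule halts_mono) (simp_all add: power2_eq_square)
qed

lemma halts_write_parents:
  assumes rd: "ready s" and M: "dual_matching 0 n (nmem s ''mate'') (rmem s ''u'') (rmem s ''v'')"
  shows "halts write_parents s (60 * (N + 1)) (\<lambda>s'. \<forall>j \<in> {1..N}.
    nmem s ''mate'' j \<noteq> 0 \<longrightarrow> nmem s' ''parent'' (nmem s ''mate'' j - 1) = (j - 1) div c0)"
proof -
  let ?p = "nmem s ''mate''"
  let ?c = "Cond (NLess (NConst 0) (NCell ''mate'' (nreg ''j'')))
          (NAssign ''parent'' (NSub (NCell ''mate'' (nreg ''j'')) (NConst 1))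
             (NCell ''owner'' (nreg ''j'')))
          Skip"
  let ?Inv = "\<lambda>k s'. \<forall>j \<in> {1..<k}. ?p j \<noteq> 0 \<longrightarrow> nmem s' ''parent'' (?p j - 1) = (j - 1) div c0"
  have inj: "inj_on ?p {j \<in> {..N} - {0}. ?p j \<noteq> 0}"
    using M by (simp add: dual_matching_def bij_betw_def)
  have "halts write_parents s (4 + ((Suc N - 1) * (20 + ntime columns + 10) + ntime columns + 4))
      (?Inv (Suc N))"
    unfolding write_parents_def
  proof (rule halts_Seq)
    show "halts (nset ''j'' (NConst 1)) s 4 (\<lambda>s'. nmem s' ''j'' 0 = 1)"
      by (intro halts_exec) simp_all
  next
    fix s1 assume ag1: "agree (nwrites (nset ''j'' (NConst 1))) (rwrites (nset ''j'' (NConst 1))) s s1"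
      and j: "nmem s1 ''j'' 0 = 1"
    have rd1: "ready s1"
      by (rule ready_agree[OF rd ag1]) simp_all
    show "halts (for_loop ''j'' columns ?c) s1
        ((Suc N - 1) * (20 + ntime columns + 10) + ntime columns + 4) (?Inv (Suc N))"
    proof (rule halts_for_loop[where Inv = ?Inv])
      fix k s' assume ag: "agree (insert ''j'' (nwrites ?c)) (rwrites ?c) s1 s'"
      show "nval columns s' = Suc N"
        by (intro ready_bound ready_agree[OF rd1 ag]) simp_all
    next
      fix k s' assume k: "1 \<le> k" "k < Suc N" and jk: "nmem s' ''j'' 0 = k" and inv: "?Inv k s'"
        and ag: "agree (insert ''j'' (nwrites ?c)) (rwrites ?c) s1 s'"
      have "ready s'"
        by (rule ready_agree[OF rd1 ag]) simp_all
      then have o: "nmem s' ''owner'' k = (k - 1) div c0"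
        using k by (simp add: ready_def)
      have p: "nmem s' ''mate'' = ?p"
        by (simp add: agree_nmem[OF ag] agree_nmem[OF ag1])
      have parent: "nmem (exec ?c s') ''parent'' = (if ?p k = 0 then nmem s' ''parent''
          else (nmem s' ''parent'')(?p k - 1 := (k - 1) div c0))"
        using jk by (auto simp: fun_eq_iff p o)
      have "?Inv (Suc k) (exec ?c s')"
      proof (intro ballI impI)
        fix j assume j: "j \<in> {1..<Suc k}" "?p j \<noteq> 0"
        show "nmem (exec ?c s') ''parent'' (?p j - 1) = (j - 1) div c0"
        proof (cases "j = k")
          case True
          then show ?thesis
            using j by (simp only: parent) simp
        next
          case False
          then have "nmem s' ''parent'' (?p j - 1) = (j - 1) div c0"
            using inv j by auto
          \<comment> \<open>Two columns never hold the same row, so this write spares the entries of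
            earlier columns. Both rows are nonzero, so truncated subtraction keeps them
            distinct.\<close>
          moreover have "?p j - 1 \<noteq> ?p k - 1" if "?p k \<noteq> 0"
          proof -
            have "?p j \<noteq> ?p k"
              using inj_onD[OF inj, of j k] False j k that by auto
            then show ?thesis
              using j(2) that by linarith
          qed
          ultimately show ?thesis
            using j by (auto simp only: parent fun_upd_def split: if_splits)
        qed
      qed
      then show "halts ?c s' 20 (\<lambda>s''. nmem s'' ''j'' 0 = k \<and>
          ?Inv (Suc k) (nupdate ''j'' 0 (Suc k) s''))"
        using jk by (intro halts_exec) simp_all
    qed (use j in simp_all)
  qed
  then show ?thesis
    by (rule halts_mono) (simp_all add: atLeastLessThanSuc_atLeastAtMost)
qed

section \<open>Matched slots and assignments to sinks\<close>

definition slot_of_row :: "(nat \<Rightarrow> nat) \<Rightarrow> nat \<Rightarrow> nat" where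
  "slot_of_row p x = (SOME j. j \<in> {1..N} \<and> p j = x)"

lemma slot_of_row:
  assumes M: "dual_matching 0 n p u v" and x: "x \<in> {1..n}"
  shows "slot_of_row p x \<in> {1..N}" "p (slot_of_row p x) = x"
proof -
  have "bij_betw p {j \<in> {..N} - {0}. p j \<noteq> 0} {1..n}"
    using M unfolding dual_matching_def by blast
  then have "x \<in> p ` {j \<in> {..N} - {0}. p j \<noteq> 0}"
    using x by (simp only: bij_betw_imp_surj_on)
  then obtain j where "j \<in> {..N} - {0}" "x = p j"
    by blast
  then have "j \<in> {1..N} \<and> p j = x"
    by auto
  then have "\<exists>j. j \<in> {1..N} \<and> p j = x"
    by (rule exI)
  then have "slot_of_row p x \<in> {1..N} \<and> p (slot_of_row p x) = x"
    unfolding slot_of_row_def by (rule someI_ex)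
  then show "slot_of_row p x \<in> {1..N}" "p (slot_of_row p x) = x"
    by auto
qed

text \<open>At most \<open>c0\<close> sources share a sink, so they can be spread injectively over
  its block of \<open>c0\<close> slots.\<close>

lemma slots_of_assignment:
  assumes f: "assignment I f"
  obtains \<sigma> where "inj_on \<sigma> {1..n}" "\<sigma> ` {1..n} \<subseteq> {1..N}"
    "\<And>x. x \<in> {1..n} \<Longrightarrow> (\<sigma> x - 1) div c0 = f (x - 1)"
proof -
  let ?F = "\<lambda>t. {i. i < n \<and> f i = t}"
  have "\<exists>g. g ` ?F t \<subseteq> {..<c0} \<and> inj_on g (?F t)" for t
    by (rule card_le_inj) (use f in \<open>simp_all add: assignment_def n_def c0_def\<close>)
  then obtain g where g: "\<And>t. g t ` ?F t \<subseteq> {..<c0}" "\<And>t. inj_on (g t) (?F t)"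
    by metis
  \<comment> \<open>The block of sink \<open>t\<close> consists of the slots
    \<open>t * c0 + 1\<close> to \<open>t * c0 + c0\<close>, and \<open>g t\<close> gives each of
    its sources an offset below \<open>c0\<close>.\<close>
  define \<sigma> where "\<sigma> x = f (x - 1) * c0 + g (f (x - 1)) (x - 1) + 1" for x
  have gl: "g (f (x - 1)) (x - 1) < c0" if "x \<in> {1..n}" for x
    using g(1)[of "f (x - 1)"] that by force
  have fl: "f (x - 1) < num_sinks I" if "x \<in> {1..n}" for x
    using f that by (auto simp: assignment_def n_def)
  have div: "(\<sigma> x - 1) div c0 = f (x - 1)" if "x \<in> {1..n}" for x
    using gl[OF that] by (simp add: \<sigma>_def)
  have "inj_on \<sigma> {1..n}"
  proof (rule inj_onI)
    fix x y assume x: "x \<in> {1..n}" and y: "y \<in> {1..n}" and eq: "\<sigma> x = \<sigma> y"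
    have feq: "f (x - 1) = f (y - 1)"
      using div[OF x] div[OF y] eq by simp
    then have "g (f (x - 1)) (x - 1) = g (f (x - 1)) (y - 1)"
      using eq by (simp add: \<sigma>_def)
    then have "x - 1 = y - 1"
      using inj_onD[OF g(2)[of "f (x - 1)"], of "x - 1" "y - 1"] x y feq by auto
    then show "x = y"
      using x y by auto
  qed
  moreover have "\<sigma> x \<in> {1..N}" if "x \<in> {1..n}" for x
  proof -
    have "Suc (f (x - 1)) * c0 \<le> num_sinks I * c0"
      using fl[OF that] by (intro mult_right_mono) auto
    then show ?thesis
      using gl[OF that] by (simp add: \<sigma>_def N_def c0_def mult.commute)
  qed
  ultimately show thesis
    using that div by blast
qed

lemma card_slots_of_sink: "card {j \<in> {1..N}. (j - 1) div c0 = t} \<le> c0"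
proof -
  have "{j \<in> {1..N}. (j - 1) div c0 = t} \<subseteq> {t * c0 + 1..t * c0 + c0}"
  proof
    fix j assume "j \<in> {j \<in> {1..N}. (j - 1) div c0 = t}"
    then have "j \<ge> 1" "t * c0 + (j - 1) mod c0 = j - 1"
      by auto
    moreover have "(j - 1) mod c0 < c0"
      using c0_pos by simp
    ultimately show "j \<in> {t * c0 + 1..t * c0 + c0}"
      unfolding atLeastAtMost_iff by linarith
  qed
  then have "card {j \<in> {1..N}. (j - 1) div c0 = t} \<le> card {t * c0 + 1..t * c0 + c0}"
    by (intro card_mono) auto
  then show ?thesis
    by simp
qed

text \<open>Reading off the sink of each matched slot respects the capacities, as a sink owns at
  most \<open>c0\<close> slots. Conversely, any competitor \<open>f\<close> lifts to an injection
  into slots of the same cost, to which duality applies.\<close>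

lemma optimal_parents:
  assumes M: "dual_matching 0 n p u v"
    and q: "\<And>j. j \<in> {1..N} \<Longrightarrow> p j \<noteq> 0 \<Longrightarrow> q (p j - 1) = (j - 1) div c0"
  shows "assignment I q" "assignment I f \<Longrightarrow> assignment_cost I q \<le> assignment_cost I f"
proof -
  let ?s = "slot_of_row p"
  have s: "?s x \<in> {1..N}" "p (?s x) = x" if "x \<in> {1..n}" for x
    using slot_of_row[OF M that] by auto
  have qs: "q (x - 1) = (?s x - 1) div c0" if "x \<in> {1..n}" for x
    using q[OF s(1)[OF that]] s(2)[OF that] that by auto
  have cost: "assignment_cost I h = (\<Sum>x \<in> {1..n}. a x (\<tau> x))"
    if "\<And>x. x \<in> {1..n} \<Longrightarrow> (\<tau> x - 1) div c0 = h (x - 1)" for h \<tau>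
  proof -
    have "(\<Sum>x \<in> {1..n}. a x (\<tau> x)) = (\<Sum>i < n. a (Suc i) (\<tau> (Suc i)))"
      by (simp add: sum.atLeast1_atMost_eq)
    also have "\<dots> = assignment_cost I h"
      unfolding assignment_cost_def n_def[symmetric]
      by (rule sum.cong) (use that[of "Suc _"] in \<open>auto simp: a_def\<close>)
    finally show ?thesis
      by simp
  qed
  show "assignment I q"
    unfolding assignment_def
  proof (intro conjI allI impI)
    fix i assume "i < num_sources I"
    then show "q i < num_sinks I"
      using qs[of "Suc i"] owner_less[OF s(1)[of "Suc i"]] by (simp add: n_def)
  next
    fix t
    have "card {i. i < n \<and> q i = t} \<le> card {j \<in> {1..N}. (j - 1) div c0 = t}"
    proof (rule card_inj_on_le[where f = "\<lambda>i. ?s (Suc i)"])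
      show "inj_on (\<lambda>i. ?s (Suc i)) {i. i < n \<and> q i = t}"
      proof (rule inj_onI)
        fix i i' assume "i \<in> {i. i < n \<and> q i = t}" "i' \<in> {i. i < n \<and> q i = t}"
          and eq: "?s (Suc i) = ?s (Suc i')"
        then have "Suc i \<in> {1..n}" "Suc i' \<in> {1..n}"
          by auto
        then have "p (?s (Suc i)) = Suc i" "p (?s (Suc i')) = Suc i'"
          using s(2) by blast+
        then show "i = i'"
          unfolding eq by linarith
      qed
      show "(\<lambda>i. ?s (Suc i)) ` {i. i < n \<and> q i = t} \<subseteq> {j \<in> {1..N}. (j - 1) div c0 = t}"
      proof (rule image_subsetI)
        fix i assume "i \<in> {i. i < n \<and> q i = t}"
        then show "?s (Suc i) \<in> {j \<in> {1..N}. (j - 1) div c0 = t}"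
          using s(1)[of "Suc i"] qs[of "Suc i"] by simp
      qed
    qed simp
    then show "card {i. i < num_sources I \<and> q i = t} \<le> cap I 0"
      using card_slots_of_sink[of t] by (simp add: n_def c0_def)
  qed
  show "assignment_cost I q \<le> assignment_cost I f" if f: "assignment I f"
  proof -
    obtain \<sigma> where \<sigma>: "inj_on \<sigma> {1..n}" "\<sigma> ` {1..n} \<subseteq> {1..N}"
      "\<And>x. x \<in> {1..n} \<Longrightarrow> (\<sigma> x - 1) div c0 = f (x - 1)"
      using slots_of_assignment[OF f] by blast
    have "(\<Sum>x \<in> {1..n}. a x (?s x)) \<le> (\<Sum>x \<in> {1..n}. a x (\<sigma> x))"
      by (rule dual_matching_optimal[OF M _ \<sigma>(1,2)]) (use s in blast)
    moreover have "assignment_cost I q = (\<Sum>x \<in> {1..n}. a x (?s x))"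
      by (rule cost) (simp only: qs)
    moreover have "assignment_cost I f = (\<Sum>x \<in> {1..n}. a x (\<sigma> x))"
      by (rule cost) (simp only: \<sigma>(3))
    ultimately show ?thesis
      by (simp only:)
  qed
qed

lemma halts_solve:
  assumes rd: "ready s" and row: "nmem s ''row'' 0 = 1"
    and M: "dual_matching 0 0 (nmem s ''mate'') (rmem s ''u'') (rmem s ''v'')"
  shows "halts (for_loop ''row'' (NAdd (nreg ''num_sources'') (NConst 1)) insert_row ;; write_parents)
    s (900 * (N + 1) ^ 3) (\<lambda>s'. assignment I (nmem s' ''parent'') \<and>
      (\<forall>f. assignment I f \<longrightarrow> assignment_cost I (nmem s' ''parent'') \<le> assignment_cost I f))"
    (is "halts (?for ;; _) _ _ ?Q")
proof -
  \<comment> \<open>The counter \<open>k\<close> is the row about to be inserted, so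
    \<open>k - 1\<close> rows are matched.\<close>
  let ?Inv = "\<lambda>k s'. dual_matching 0 (k - 1) (nmem s' ''mate'') (rmem s' ''u'') (rmem s' ''v'')"
  let ?b = "NAdd (nreg ''num_sources'') (NConst 1)"
  have "halts (?for ;; write_parents) s
      (((Suc n - 1) * (700 * (N + 1) ^ 2 + ntime ?b + 10) + ntime ?b + 4) + 60 * (N + 1)) ?Q"
  proof (rule halts_Seq[where P = "?Inv (Suc n)"])
    show "halts ?for s ((Suc n - 1) * (700 * (N + 1) ^ 2 + ntime ?b + 10) + ntime ?b + 4)
        (?Inv (Suc n))"
    proof (rule halts_for_loop[where Inv = ?Inv])
      fix k s' assume ag: "agree (insert ''row'' (nwrites insert_row)) (rwrites insert_row) s s'"
      have "ready s'"
        by (rule ready_agree[OF rd ag]) simp_all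
      then show "nval ?b s' = Suc n"
        by (simp add: ready_def)
    next
      fix k s' assume k: "1 \<le> k" "k < Suc n" and row: "nmem s' ''row'' 0 = k" and inv: "?Inv k s'"
        and ag: "agree (insert ''row'' (nwrites insert_row)) (rwrites insert_row) s s'"
      have rd': "ready s'"
        by (rule ready_agree[OF rd ag]) simp_all
      have "halts insert_row s' (700 * (N + 1) ^ 2)
          (\<lambda>s'. dual_matching 0 (Suc (k - 1)) (nmem s' ''mate'') (rmem s' ''u'') (rmem s' ''v''))"
        by (rule halts_insert_row[OF rd' _ _ inv]) (use k row in auto)
      then show "halts insert_row s' (700 * (N + 1) ^ 2)
          (\<lambda>s''. nmem s'' ''row'' 0 = k \<and> ?Inv (Suc k) (nupdate ''row'' 0 (Suc k) s''))"
      proof (rule halts_mono[OF _ order_refl])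
        fix s'' assume ag': "agree (nwrites insert_row) (rwrites insert_row) s' s''"
          and "dual_matching 0 (Suc (k - 1)) (nmem s'' ''mate'') (rmem s'' ''u'') (rmem s'' ''v'')"
        then show "nmem s'' ''row'' 0 = k \<and> ?Inv (Suc k) (nupdate ''row'' 0 (Suc k) s'')"
          using k row by (simp add: agree_nmem[OF ag'])
      qed
    qed (use row M in simp_all)
  next
    fix s1 assume ag: "agree (nwrites ?for) (rwrites ?for) s s1" and "?Inv (Suc n) s1"
    then have M1: "dual_matching 0 n (nmem s1 ''mate'') (rmem s1 ''u'') (rmem s1 ''v'')"
      by simp
    have rd1: "ready s1"
      by (rule ready_agree[OF rd ag]) simp_all
    show "halts write_parents s1 (60 * (N + 1)) ?Q"
    proof (rule halts_mono[OF halts_write_parents[OF rd1 M1] order_refl])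
      fix s' :: state assume "\<forall>j \<in> {1..N}. nmem s1 ''mate'' j \<noteq> 0 \<longrightarrow>
          nmem s' ''parent'' (nmem s1 ''mate'' j - 1) = (j - 1) div c0"
      then show "?Q s'"
        using optimal_parents[OF M1, of "nmem s' ''parent''"] by blast
    qed
  qed
  then show ?thesis
  proof (rule halts_mono)
    \<comment> \<open>Here the number of rows is bounded by the number of slots, so the sources
      disappear from the time bound.\<close>
    have "(Suc n - 1) * (700 * (N + 1) ^ 2 + ntime ?b + 10)
        \<le> (N + 1) * (700 * (N + 1) ^ 2 + ntime ?b + 10)"
      using n_le_N by (intro mult_right_mono) auto
    then show "((Suc n - 1) * (700 * (N + 1) ^ 2 + ntime ?b + 10) + ntime ?b + 4) + 60 * (N + 1)
        \<le> 900 * (N + 1) ^ 3"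
      by (simp add: power2_eq_square power3_eq_cube algebra_simps)
  qed
qed

end

section \<open>Set-up and the complete program\<close>

lemma halts_build_slots:
  assumes inst: "flamecast_instance I"
  defines "c0 \<equiv> cap I 0" and "m \<equiv> num_sinks I"
  shows "halts build_slots (input_state I) (100 * (c0 * m + 1)) (\<lambda>s.
    nmem s ''slots'' 0 = c0 * m \<and> (\<forall>j \<in> {1..c0 * m}. nmem s ''owner'' j = (j - 1) div c0))"
proof -
  let ?s = "input_state I"
  let ?body = "ninc ''slots'' ;; NAssign ''owner'' (nreg ''slots'') (nreg ''j'')"
  let ?inner = "for_loop ''k'' (nreg ''capacities'') ?body"
  let ?Inv = "\<lambda>N s. nmem s ''slots'' 0 = N \<and> (\<forall>j \<in> {1..N}. nmem s ''owner'' j = (j - 1) div c0)"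
  have caps: "cap I 0 \<in> set (capacities I)" "capacities I \<noteq> []"
    using inst by (auto simp: flamecast_instance_def cap_def intro!: nth_mem)
  then have c0_pos: "c0 > 0"
    using inst by (force simp: c0_def flamecast_instance_def)
  have init: "nmem ?s ''capacities'' 0 = c0" "nmem ?s ''num_sinks'' 0 = m"
    using caps(2) by (simp_all add: input_state_def nat_array_def c0_def cap_def m_def)
  have "halts build_slots ?s ((m - 0) * ((4 + (c0 * 30 + 6)) + ntime (nreg ''num_sinks'') + 10)
      + ntime (nreg ''num_sinks'') + 4) (?Inv (m * c0))"
    unfolding build_slots_def
  proof (rule halts_for_loop[where Inv = "\<lambda>t s. ?Inv (t * c0) s"])
    fix t s'
    assume "agree (insert ''j'' (nwrites (nset ''k'' (NConst 0) ;; ?inner)))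
      (rwrites (nset ''k'' (NConst 0) ;; ?inner)) ?s s'"
    then show "nval (nreg ''num_sinks'') s' = m"
      using init by (simp add: agree_nmem)
  next
    fix t s'
    assume t: "t < m" "nmem s' ''j'' 0 = t" and inv: "?Inv (t * c0) s'"
      and ag: "agree (insert ''j'' (nwrites (nset ''k'' (NConst 0) ;; ?inner)))
        (rwrites (nset ''k'' (NConst 0) ;; ?inner)) ?s s'"
    have caps': "nmem s' ''capacities'' 0 = c0"
      using init by (simp add: agree_nmem[OF ag])
    show "halts (nset ''k'' (NConst 0) ;; ?inner) s' (4 + (c0 * 30 + 6))
      (\<lambda>s''. nmem s'' ''j'' 0 = t \<and> ?Inv (Suc t * c0) (nupdate ''j'' 0 (Suc t) s''))"
    proof (rule halts_Seq)
      show "halts (nset ''k'' (NConst 0)) s' 4 (\<lambda>s''. nmem s'' ''k'' 0 = 0 \<and> ?Inv (t * c0) s'')"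
        using inv by (intro halts_exec) simp_all
    next
      fix s1 assume s1: "nmem s1 ''k'' 0 = 0 \<and> ?Inv (t * c0) s1"
        and ag1: "agree (nwrites (nset ''k'' (NConst 0))) (rwrites (nset ''k'' (NConst 0))) s' s1"
      have t1: "nmem s1 ''j'' 0 = t" "nmem s1 ''capacities'' 0 = c0"
        using t(2) caps' by (simp_all add: agree_nmem[OF ag1])
      have "halts ?inner s1 ((c0 - 0) * (18 + ntime (nreg ''capacities'') + 10)
          + ntime (nreg ''capacities'') + 4) (?Inv (t * c0 + c0))"
      proof (rule halts_for_loop[where Inv = "\<lambda>k s. ?Inv (t * c0 + k) s"])
        fix k s2 assume "agree (insert ''k'' (nwrites ?body)) (rwrites ?body) s1 s2"
        then show "nval (nreg ''capacities'') s2 = c0"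
          using t1 by (simp add: agree_nmem)
      next
        fix k s2 assume k: "k < c0" "nmem s2 ''k'' 0 = k" and inv2: "?Inv (t * c0 + k) s2"
          and ag2: "agree (insert ''k'' (nwrites ?body)) (rwrites ?body) s1 s2"
        have j2: "nmem s2 ''j'' 0 = t"
          using t1 by (simp add: agree_nmem[OF ag2])
        \<comment> \<open>Slots are numbered from 1, so the slot being added is
          \<open>t * c0 + k + 1\<close>.\<close>
        have "(t * c0 + k) div c0 = t"
          using k(1) by simp
        then show "halts ?body s2 18 (\<lambda>s3. nmem s3 ''k'' 0 = k \<and>
            ?Inv (t * c0 + Suc k) (nupdate ''k'' 0 (Suc k) s3))"
          using k(2) inv2 j2 by (intro halts_exec) auto
      qed (use s1 in simp_all)
      then show "halts ?inner s1 (c0 * 30 + 6)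
          (\<lambda>s''. nmem s'' ''j'' 0 = t \<and> ?Inv (Suc t * c0) (nupdate ''j'' 0 (Suc t) s''))"
      proof (rule halts_mono)
        fix s2 assume ag2: "agree (nwrites ?inner) (rwrites ?inner) s1 s2"
          and "?Inv (t * c0 + c0) s2"
        then show "nmem s2 ''j'' 0 = t \<and> ?Inv (Suc t * c0) (nupdate ''j'' 0 (Suc t) s2)"
          using t1 by (simp add: agree_nmem[OF ag2] add.commute)
      qed simp
    qed
  qed (simp_all add: input_state_def)
  then show ?thesis
  proof (rule halts_mono)
    have "(m - 0) * ((4 + (c0 * 30 + 6)) + ntime (nreg ''num_sinks'') + 10)
        + ntime (nreg ''num_sinks'') + 4 = 30 * (c0 * m) + 22 * m + 6"
      by (simp add: algebra_simps)
    also have "\<dots> \<le> 100 * (c0 * m + 1)"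
    proof -
      define P where "P = c0 * m"
      \<comment> \<open>Each sink costs a constant besides its slots; \<open>c0 \<ge> 1\<close>
        absorbs this into the number of slots.\<close>
      have "m \<le> P"
        using c0_pos by (simp add: P_def)
      then have "22 * m \<le> 22 * P"
        by simp
      then show ?thesis
        unfolding P_def[symmetric] by simp
    qed
    finally show "(m - 0) * ((4 + (c0 * 30 + 6)) + ntime (nreg ''num_sinks'') + 10)
      + ntime (nreg ''num_sinks'') + 4 \<le> 100 * (c0 * m + 1)" .
  qed (simp add: mult.commute)
qed

text \<open>Too large a number of sources is recognised before any loop over rows, so the bound is
  free of that number in both cases.\<close>

lemma hungarian_correct:
  assumes inst: "flamecast_instance I" and easy: "exponent I = 1 \<or> num_layers I = 0"
  shows "halts hungarian (input_state I) (1100 * (cap I 0 * num_sinks I + 1) ^ 3) (correct_output I)"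
proof -
  let ?N = "cap I 0 * num_sinks I" and ?n = "num_sources I" and ?s = "input_state I"
  let ?init = "nset ''feasible'' (NConst 1) ;; nset ''row'' (NConst 1)"
  let ?solve = "for_loop ''row'' (NAdd (nreg ''num_sources'') (NConst 1)) insert_row ;; write_parents"
  let ?b = "NLess (nreg ''slots'') (nreg ''num_sources'')"
  have "halts hungarian ?s
      (100 * (?N + 1) + (btime ?b + (20 + 900 * (?N + 1) ^ 3) + 1)) (correct_output I)"
    unfolding hungarian_def
  proof (rule halts_Seq[OF halts_build_slots[OF inst]])
    fix s assume ag: "agree (nwrites build_slots) (rwrites build_slots) ?s s"
      and s: "nmem s ''slots'' 0 = ?N \<and>
        (\<forall>j \<in> {1..?N}. nmem s ''owner'' j = (j - 1) div cap I 0)"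
    have src: "nmem s ''num_sources'' 0 = ?n"
      by (simp add: agree_nmem[OF ag] input_state_def nat_array_def)
    show "halts (Cond ?b Skip (?init ;; ?solve)) s (btime ?b + (20 + 900 * (?N + 1) ^ 3) + 1)
        (correct_output I)"
    proof (rule halts_Cond)
      assume "bval ?b s"
      then have "?n > ?N"
        using s src by simp
      moreover have "nmem s ''feasible'' 0 = 0"
        by (simp add: agree_nmem[OF ag] input_state_def)
      ultimately have "correct_output I s"
        by (intro correct_outputI[OF inst easy]) simp_all
      then show "halts Skip s (20 + 900 * (?N + 1) ^ 3) (correct_output I)"
        by (intro halts_exec) simp_all
    next
      assume "\<not> bval ?b s"
      then have le: "?n \<le> ?N"
        using s src by simp
      interpret solvable_instance I ?n ?N "cap I 0"
          "\<lambda>x j. norm (source_pos I ! (x - 1) - sink_pos I ! ((j - 1) div cap I 0))"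
        by unfold_locales (use inst le in simp_all)
      have rd: "ready s"
        using s src by (simp add: ready_def agree_rmem[OF ag])
      have zero: "nmem s ''mate'' = (\<lambda>_. 0)" "rmem s ''u'' = (\<lambda>_. 0)" "rmem s ''v'' = (\<lambda>_. 0)"
        by (simp_all add: agree_nmem[OF ag] agree_rmem[OF ag] input_state_def)
      show "halts (?init ;; ?solve) s (20 + 900 * (?N + 1) ^ 3) (correct_output I)"
      proof (rule halts_Seq)
        show "halts ?init s 20 (\<lambda>s'. nmem s' ''feasible'' 0 = 1 \<and> nmem s' ''row'' 0 = 1)"
          by (intro halts_exec) simp_all
      next
        fix s1 assume ag1: "agree (nwrites ?init) (rwrites ?init) s s1"
          and s1: "nmem s1 ''feasible'' 0 = 1 \<and> nmem s1 ''row'' 0 = 1"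
        have rd1: "ready s1"
          by (rule ready_agree[OF rd ag1]) simp_all
        have M1: "dual_matching 0 0 (nmem s1 ''mate'') (rmem s1 ''u'') (rmem s1 ''v'')"
          using dual_matching_init zero by (simp add: agree_nmem[OF ag1] agree_rmem[OF ag1])
        show "halts ?solve s1 (900 * (?N + 1) ^ 3) (correct_output I)"
        proof (rule halts_mono[OF halts_solve[OF rd1 _ M1] order_refl])
          show "nmem s1 ''row'' 0 = 1"
            using s1 by simp
        next
          fix s2 assume ag2: "agree (nwrites ?solve) (rwrites ?solve) s1 s2"
            and opt: "assignment I (nmem s2 ''parent'') \<and> (\<forall>f. assignment I f \<longrightarrow>
              assignment_cost I (nmem s2 ''parent'') \<le> assignment_cost I f)"
          have "nmem s2 ''feasible'' 0 = 1" "nmem s2 ''num_steiner'' 0 = 0"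
            using s1 by (simp_all add: agree_nmem[OF ag2] agree_nmem[OF ag1] agree_nmem[OF ag]
                input_state_def)
          then show "correct_output I s2"
            using opt le by (intro correct_outputI[OF inst easy]) auto
        qed
      qed
    qed
  qed
  then show ?thesis
    by (rule halts_mono) (simp_all add: power3_eq_cube algebra_simps)
qed

theorem theorem7:
  "\<exists>(prog :: com) (time :: nat \<Rightarrow> real).
     time \<in> O(\<lambda>N. real N ^ 3) \<and>
     (\<forall>I. flamecast_instance I \<and> (exponent I = 1 \<or> num_layers I = 0) \<longrightarrow>
        (\<exists>t s. runs prog (input_state I) t s \<and>
           real t \<le> time (cap I 0 * num_sinks I) \<and>
           correct_output I s))"
\<comment> \<open>The shift by 1 covers instances without sinks: the program takes some steps even
  then, while \<open>N ^ 3\<close> is 0.\<close>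
proof (rule exI[of _ hungarian], rule exI[of _ "\<lambda>N. 1100 * (real N + 1) ^ 3"], intro conjI allI impI)
  show "(\<lambda>N. 1100 * (real N + 1) ^ 3) \<in> O(\<lambda>N. real N ^ 3)"
  proof (rule bigoI)
    show "\<forall>\<^sub>F N in sequentially. norm (1100 * (real N + 1) ^ 3) \<le> 8800 * norm (real N ^ 3)"
      using eventually_ge_at_top[of 1]
    proof eventually_elim
      case (elim N)
      \<comment> \<open>For \<open>N \<ge> 1\<close> the shift costs at most a factor
        \<open>2 ^ 3\<close>, and 8 times 1100 is 8800.\<close>
      then have "(real N + 1) ^ 3 \<le> (2 * real N) ^ 3"
        by (intro power_mono) auto
      then show ?case
        by (simp add: power_mult_distrib)
    qed
  qed
next
  fix I assume "flamecast_instance I \<and> (exponent I = 1 \<or> num_layers I = 0)"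
  then obtain t s where *: "runs hungarian (input_state I) t s"
      "t \<le> 1100 * (cap I 0 * num_sinks I + 1) ^ 3" "correct_output I s"
    using hungarian_correct unfolding halts_def by blast
  then have "real t \<le> real (1100 * (cap I 0 * num_sinks I + 1) ^ 3)"
    by (simp only: of_nat_le_iff)
  then have "real t \<le> 1100 * (real (cap I 0 * num_sinks I) + 1) ^ 3"
    by (simp add: add.commute)
  then show "\<exists>t s. runs hungarian (input_state I) t s \<and>
      real t \<le> 1100 * (real (cap I 0 * num_sinks I) + 1) ^ 3 \<and> correct_output I s"
    using * by blast
qed

end
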